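(* Let $d\ge 2$ be a fixed integer. If $D$ is a sourceless digraph with $n$ vertices, maximum out-degree $\Delta^+(D)\le d$, and no $\vec{C}_3$, $\vec{C}_4^{-}$, $C_4^{\Uparrow}$, or $C_6^{\Uparrow}$ as a subgraph, then $D$ has a quasi-kernel of order at most $\frac{(d^2+4)n}{(d+2)^2}$. Moreover, such a quasi-kernel can be found in $O(n^2)$ time.
   Context: Digraphs are finite, without loops and without repeated edges $(u,v)$; both $(u,v)$ and $(v,u)$ may be present. A source is a vertex with in-degree zero; a digraph is sourceless if it has no source. $\dist(v,u)$ is the length of a shortest directed path from $v$ to $u$ ($\infty$ if none exists). A quasi-kernel of $D$ is an independent set $Q$ (no edges in either direction between vertices of $Q$) such that for every vertex $u$ of $D$ there is $v\in Q$ with $\dist(v,u)\le 2$. The forbidden digraphs (as not necessarily induced subgraphs, with distinct vertices) are: $\vec{C}_3$: the directed triangle $a\to b\to c\to a$; $\vec{C}_4^{-}$: the directed 4-cycle with one edge reversed, i.e. edges $a\to b\to c\to e$ and $a\to e$; $C_4^{\Uparrow}$: the 4-cycle formed by two internally disjoint directed paths of length 2 with the same start and end, $a\to b\to e$ and $a\to c\to e$; $C_6^{\Uparrow}$: the 6-cycle formed by two internally disjoint directed paths of length 3 with the same start and end, $a\to b_1\to b_2\to e$ and $a\to c_1\to c_2\to e$. For the running time, $D$ is stored as a dictionary keyed by vertices giving each vertex's in-neighbourhood and out-neighbourhood as sets, with constant time lookup; $d$ is fixed, so the constant in $O(n^2)$ may depend on $d$. *)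

theory Defs
  imports
    "Graph_Theory.Graph_Theory"
    "HOL-Library.Extended_Nat"
    "HOL-Library.Landau_Symbols"
begin

section \<open>Digraphs and quasi-kernels\<close>

text \<open>
  Digraphs are the finite, loop-free digraphs without parallel arcs of the locale
  \<^locale>\<open>pair_digraph\<close>; both \<open>(u, v)\<close> and \<open>(v, u)\<close> may be arcs.  The digraph without
  vertices is allowed.
\<close>

definition sourceless :: "'a pair_pre_digraph \<Rightarrow> bool" where
  "sourceless D \<longleftrightarrow> (\<forall>v \<in> pverts D. in_degree D v \<noteq> 0)"

text \<open>For the digraph without vertices this is \<open>0\<close>, since \<open>Sup {} = 0\<close> on the naturals.\<close>
definition max_out_degree :: "'a pair_pre_digraph \<Rightarrow> nat" where
  "max_out_degree D = (SUP v \<in> pverts D. out_degree D v)"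

text \<open>The infimum of the empty set is \<open>\<infinity>\<close> in \<^typ>\<open>enat\<close>.\<close>
definition dist_to :: "'a pair_pre_digraph \<Rightarrow> 'a \<Rightarrow> 'a \<Rightarrow> enat" where
  "dist_to D v u = (INF p \<in> {p. pre_digraph.apath D v p u}. enat (length p))"

definition independent_set :: "'a pair_pre_digraph \<Rightarrow> 'a set \<Rightarrow> bool" where
  "independent_set D Q \<longleftrightarrow> Q \<subseteq> pverts D \<and> (\<forall>u \<in> Q. \<forall>v \<in> Q. \<not> u \<rightarrow>\<^bsub>D\<^esub> v)"

definition quasi_kernel :: "'a pair_pre_digraph \<Rightarrow> 'a set \<Rightarrow> bool" where
  "quasi_kernel D Q \<longleftrightarrow>
     independent_set D Q \<and> (\<forall>u \<in> pverts D. \<exists>v \<in> Q. dist_to D v u \<le> 2)"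

text \<open>Containment as a not necessarily induced subgraph, up to isomorphism.\<close>
definition contains_copy :: "'a pair_pre_digraph \<Rightarrow> 'b pair_pre_digraph \<Rightarrow> bool" where
  "contains_copy D H \<longleftrightarrow>
     (\<exists>H' :: ('a, 'a \<times> 'a) pre_digraph. subgraph H' D \<and> digraph_iso H H')"

definition C3_directed :: "nat pair_pre_digraph" where
  "C3_directed = \<lparr> pverts = {0, 1, 2}, parcs = {(0, 1), (1, 2), (2, 0)} \<rparr>"

definition C4_minus :: "nat pair_pre_digraph" where
  "C4_minus = \<lparr> pverts = {0, 1, 2, 3}, parcs = {(0, 1), (1, 2), (2, 3), (0, 3)} \<rparr>"

definition C4_upup :: "nat pair_pre_digraph" where
  "C4_upup = \<lparr> pverts = {0, 1, 2, 3}, parcs = {(0, 1), (1, 3), (0, 2), (2, 3)} \<rparr>"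

definition C6_upup :: "nat pair_pre_digraph" where
  "C6_upup = \<lparr> pverts = {0, 1, 2, 3, 4, 5},
               parcs = {(0, 1), (1, 2), (2, 5), (0, 3), (3, 4), (4, 5)} \<rparr>"


section \<open>Machine model\<close>

text \<open>
  Running time is measured on a deeply embedded while-language over a random access memory
  whose cells hold natural numbers.  The memory consists of named tables with two indices
  (dictionaries of dictionaries) with constant-time access; a scalar \<open>x\<close> is the cell
  \<open>x[0, 0]\<close>, and a one-dimensional table \<open>x\<close> uses the cells \<open>x[0, i]\<close>.  The only arithmetic
  at unit cost is addition, truncated subtraction and comparison; there is deliberately no
  multiplication, division or bit operation.
\<close>

type_synonym tname = string
type_synonym memory = "tname \<Rightarrow> nat \<Rightarrow> nat \<Rightarrow> nat"

datatype aexp =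
    Const nat
  | Cell tname aexp aexp
  | Plus aexp aexp
  | Minus aexp aexp

datatype bexp =
    Less aexp aexp
  | Neg bexp
  | Conj bexp bexp

datatype com =
    Skip
  | Assign tname aexp aexp aexp
  | Seq com com
  | Cond bexp com com
  | While bexp com

primrec aval :: "aexp \<Rightarrow> memory \<Rightarrow> nat" where
  "aval (Const n) s = n"
| "aval (Cell x a b) s = s x (aval a s) (aval b s)"
| "aval (Plus a b) s = aval a s + aval b s"
| "aval (Minus a b) s = aval a s - aval b s"

primrec bval :: "bexp \<Rightarrow> memory \<Rightarrow> bool" where
  "bval (Less a b) s \<longleftrightarrow> aval a s < aval b s"
| "bval (Neg b) s \<longleftrightarrow> \<not> bval b s"
| "bval (Conj b c) s \<longleftrightarrow> bval b s \<and> bval c s"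

primrec acost :: "aexp \<Rightarrow> nat" where
  "acost (Const n) = 1"
| "acost (Cell x a b) = 1 + acost a + acost b"
| "acost (Plus a b) = 1 + acost a + acost b"
| "acost (Minus a b) = 1 + acost a + acost b"

primrec bcost :: "bexp \<Rightarrow> nat" where
  "bcost (Less a b) = 1 + acost a + acost b"
| "bcost (Neg b) = 1 + bcost b"
| "bcost (Conj b c) = 1 + bcost b + bcost c"

definition update_cell :: "memory \<Rightarrow> tname \<Rightarrow> nat \<Rightarrow> nat \<Rightarrow> nat \<Rightarrow> memory" where
  "update_cell s x i j k = s(x := (s x)(i := (s x i)(j := k)))"

text \<open>
  \<open>exec c s t s'\<close>: started in memory \<open>s\<close>, the program \<open>c\<close> halts after \<open>t\<close> steps in memory \<open>s'\<close>.
\<close>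
inductive exec :: "com \<Rightarrow> memory \<Rightarrow> nat \<Rightarrow> memory \<Rightarrow> bool" where
  Skip: "exec Skip s 1 s"
| Assign: "exec (Assign x a b e) s (1 + acost a + acost b + acost e)
             (update_cell s x (aval a s) (aval b s) (aval e s))"
| Seq: "exec c\<^sub>1 s\<^sub>1 t\<^sub>1 s\<^sub>2 \<Longrightarrow> exec c\<^sub>2 s\<^sub>2 t\<^sub>2 s\<^sub>3 \<Longrightarrow> exec (Seq c\<^sub>1 c\<^sub>2) s\<^sub>1 (t\<^sub>1 + t\<^sub>2) s\<^sub>3"
| CondTrue: "bval b s \<Longrightarrow> exec c\<^sub>1 s t s' \<Longrightarrow> exec (Cond b c\<^sub>1 c\<^sub>2) s (1 + bcost b + t) s'"
| CondFalse: "\<not> bval b s \<Longrightarrow> exec c\<^sub>2 s t s' \<Longrightarrow> exec (Cond b c\<^sub>1 c\<^sub>2) s (1 + bcost b + t) s'"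
| WhileFalse: "\<not> bval b s \<Longrightarrow> exec (While b c) s (1 + bcost b) s"
| WhileTrue: "bval b s\<^sub>1 \<Longrightarrow> exec c s\<^sub>1 t\<^sub>1 s\<^sub>2 \<Longrightarrow> exec (While b c) s\<^sub>2 t\<^sub>2 s\<^sub>3 \<Longrightarrow>
    exec (While b c) s\<^sub>1 (1 + bcost b + t\<^sub>1 + t\<^sub>2) s\<^sub>3"

inductive_cases SkipE: "exec Skip s t s'"
  and AssignE: "exec (Assign x a b e) s t s'"
  and SeqE: "exec (Seq c\<^sub>1 c\<^sub>2) s t s'"
  and CondE: "exec (Cond b c\<^sub>1 c\<^sub>2) s t s'"
  and WhileE: "exec (While b c) s t s'"

lemma exec_deterministic:
  "exec c s t s' \<Longrightarrow> exec c s u s'' \<Longrightarrow> u = t \<and> s'' = s'"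
proof (induction arbitrary: u s'' rule: exec.induct)
  case (Seq c\<^sub>1 s\<^sub>1 t\<^sub>1 s\<^sub>2 c\<^sub>2 t\<^sub>2 s\<^sub>3)
  from Seq.prems show ?case by (rule SeqE) (auto dest: Seq.IH)
next
  case (CondTrue b s c\<^sub>1 t s' c\<^sub>2)
  from CondTrue.prems show ?case by (rule CondE) (auto simp: CondTrue.hyps(1) dest: CondTrue.IH)
next
  case (CondFalse b s c\<^sub>2 t s' c\<^sub>1)
  from CondFalse.prems show ?case by (rule CondE) (auto simp: CondFalse.hyps(1) dest: CondFalse.IH)
next
  case (WhileFalse b s c)
  from WhileFalse.prems show ?case by (rule WhileE) (auto simp: WhileFalse.hyps(1))
next
  case (WhileTrue b s\<^sub>1 c t\<^sub>1 s\<^sub>2 t\<^sub>2 s\<^sub>3)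
  from WhileTrue.prems show ?case by (rule WhileE) (auto simp: WhileTrue.hyps(1) dest: WhileTrue.IH)
qed (auto elim: SkipE AssignE)

text \<open>
  The dictionary in which a digraph with arbitrary natural numbers as vertices is stored.  The
  keys, and for every key the two neighbourhoods, can be enumerated, in an unspecified order
  (tables \<open>V\<close>, \<open>in\<close>, \<open>out\<close> and their lengths \<open>n\<close>, \<open>indeg\<close>, \<open>outdeg\<close>); membership in a
  neighbourhood is a single lookup in the table \<open>arc\<close>.  Cells of the enumerations beyond their
  lengths are arbitrary; all other tables are initially zero.
\<close>
definition stores :: "memory \<Rightarrow> nat pair_pre_digraph \<Rightarrow> bool" where
  "stores s D \<longleftrightarrow>
     s ''n'' 0 0 = card (pverts D) \<and>
     bij_betw (s ''V'' 0) {..<card (pverts D)} (pverts D) \<and>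
     (\<forall>v \<in> pverts D.
        s ''indeg'' 0 v = in_degree D v \<and>
        bij_betw (s ''in'' v) {..<in_degree D v} {u. u \<rightarrow>\<^bsub>D\<^esub> v} \<and>
        s ''outdeg'' 0 v = out_degree D v \<and>
        bij_betw (s ''out'' v) {..<out_degree D v} {u. v \<rightarrow>\<^bsub>D\<^esub> u}) \<and>
     (\<forall>u v. s ''arc'' u v = (if u \<rightarrow>\<^bsub>D\<^esub> v then 1 else 0)) \<and>
     (\<forall>x i j. x \<notin> {''n'', ''V'', ''indeg'', ''in'', ''outdeg'', ''out'', ''arc''} \<longrightarrow>
        s x i j = 0)"

text \<open>The set returned by a program, given by its (finitely many) nonzero entries.\<close>
definition result :: "memory \<Rightarrow> nat set" where
  "result s = {v. s ''Q'' 0 v \<noteq> 0}"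

end

theory Submission
  imports Defs
begin

text \<open>
  Since \<open>D\<close> is sourceless, there is a minimal set \<open>W\<close> such that every vertex has an in-neighbour in
  \<open>W\<close>; by minimality every \<open>w \<in> W\<close> has a private out-neighbour. Repeatedly choose a remaining vertex
  of \<open>W\<close> with as many remaining out-neighbours outside \<open>W\<close> as possible and delete it together with
  its out-neighbours; when \<open>W\<close> is exhausted, choose arbitrary remaining vertices. Arcs between chosen
  vertices lead from later to earlier ones, so the chosen vertices have a kernel, and it is a
  quasi-kernel of \<open>D\<close>.

  If a chosen vertex deletes \<open>x\<close> out-neighbours outside \<open>W\<close> and \<open>y\<close> in \<open>W\<close>, then \<open>x + y\<close> vertices
  are kept out of the quasi-kernel. The vertices outside \<open>W\<close> not deleted in this way have a parent
  among the \<open>y\<close> vertices, each of which has at most \<open>x\<close> such children by the greedy choice, so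
  \<open>(1 + x) (1 + y)\<close> vertices are accounted for, and \<open>4 d (1 + x) (1 + y) \<le> (x + y) (d + 2)\<^sup>2\<close> if
  \<open>1 \<le> x + y \<le> d\<close>. If \<open>x = y = 0\<close>, the private out-neighbour of the chosen vertex was chosen
  before, and at most one of the two is in the kernel; as private out-neighbours are distinct, half of
  these vertices are saved, and \<open>1/2 \<ge> 4 d / (d + 2)\<^sup>2\<close>.
\<close>

section \<open>Minimal total dominating sets and greedy orders\<close>

text \<open>With \<open>t = x + y\<close>, AM-GM gives
  \<open>4 (1 + x) (1 + y) \<le> (t + 2)^2\<close>, and \<open>d (t + 2)^2 \<le> t (d + 2)^2\<close>
  holds for \<open>t \<le> d\<close> as soon as \<open>t d \<ge> 4\<close>. The latter can fail only
  for \<open>t = 1\<close>, where the claim reduces to \<open>(d - 2)^2 \<ge> 0\<close>.\<close>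

lemma block_bound:
  fixes d x y :: nat
  assumes "2 \<le> d" "1 \<le> x + y" "x + y \<le> d"
  shows "4 * d * ((1 + x) * (1 + y)) \<le> (x + y) * (d + 2)\<^sup>2"
proof -
  define t where "t = int x + int y"
  have t: "1 \<le> t" "t \<le> int d" using assms by (auto simp: t_def)
  have "4 * int d * ((1 + int x) * (1 + int y)) \<le> t * (int d + 2)\<^sup>2"
  proof (cases "t = 1")
    case True
    then have "x = 0 \<and> y = 1 \<or> x = 1 \<and> y = 0" by (auto simp: t_def)
    moreover have "0 \<le> (int d - 2)\<^sup>2" by simp
    ultimately show ?thesis using True by (auto simp: power2_eq_square algebra_simps)
  next
    case False
    have "4 * ((1 + int x) * (1 + int y)) \<le> (t + 2)\<^sup>2"
      using zero_le_power2[of "int x - int y"] by (simp add: t_def power2_eq_square algebra_simps)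
    then have "int d * (4 * ((1 + int x) * (1 + int y))) \<le> int d * (t + 2)\<^sup>2"
      by (intro mult_left_mono) auto
    also have "\<dots> \<le> t * (int d + 2)\<^sup>2"
    proof -
      have "2 * 2 \<le> t * int d" using t False assms(1) by (intro mult_mono) auto
      \<comment> \<open>This product is exactly \<open>t (d + 2)^2 - d (t + 2)^2\<close>.\<close>
      then have "0 \<le> (int d - t) * (t * int d - 4)" using t by simp
      then show ?thesis by (simp add: power2_eq_square algebra_simps)
    qed
    finally show ?thesis by (simp add: algebra_simps)
  qed
  then have "int (4 * d * ((1 + x) * (1 + y))) \<le> int ((x + y) * (d + 2)\<^sup>2)"
    by (simp add: t_def power2_eq_square algebra_simps)
  then show ?thesis by (simp only: of_nat_le_iff)
qed

text \<open>The kernel of the subdigraph induced by the list, provided that all its arcs lead from later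
  to earlier list elements.\<close>
primrec list_kernel :: "('a \<Rightarrow> 'a set) \<Rightarrow> 'a list \<Rightarrow> 'a set" where
  "list_kernel N [] = {}"
| "list_kernel N (v # vs) =
     (if v \<in> \<Union> (N ` list_kernel N vs) then list_kernel N vs else insert v (list_kernel N vs))"

lemma list_kernel_subset: "list_kernel N vs \<subseteq> set vs"
  by (induction vs) auto

lemma list_kernel_dominates:
  "v \<in> set vs \<Longrightarrow> v \<in> list_kernel N vs \<or> (\<exists>k\<in>list_kernel N vs. v \<in> N k)"
  by (induction vs) auto

text \<open>By sortedness a new head has no arc into the tail, and it is added only if no kernel
  vertex of the tail has an arc to it.\<close>

lemma list_kernel_independent:
  assumes "\<And>v. v \<notin> N v" "sorted_wrt (\<lambda>u v. v \<notin> N u) vs"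
    "u \<in> list_kernel N vs" "v \<in> list_kernel N vs"
  shows "v \<notin> N u"
  using assms(2-4)
proof (induction vs)
  case (Cons a vs)
  then show ?case using assms(1) list_kernel_subset[of N vs] by (auto split: if_splits)
qed simp

section \<open>Minimal total dominating sets\<close>

locale out_nbhds =
  fixes V :: "'a set" and N :: "'a \<Rightarrow> 'a set" and d :: nat
  assumes finite_V: "finite V"
    and N_subset: "v \<in> V \<Longrightarrow> N v \<subseteq> V"
    and N_irrefl: "v \<notin> N v"
    and card_N: "v \<in> V \<Longrightarrow> card (N v) \<le> d"
    and two_le_d: "2 \<le> d"
    and has_parent: "u \<in> V \<Longrightarrow> \<exists>v\<in>V. u \<in> N v"
begin

lemma finite_N: "v \<in> V \<Longrightarrow> finite (N v)"
  using N_subset finite_V finite_subset by blast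

definition private_child :: "'a set \<Rightarrow> 'a \<Rightarrow> 'a \<Rightarrow> bool" where
  "private_child W w p \<longleftrightarrow> p \<in> N w \<and> (\<forall>w'\<in>W. p \<in> N w' \<longrightarrow> w' = w)"

definition minimal_total_dominating :: "'a set \<Rightarrow> bool" where
  "minimal_total_dominating W \<longleftrightarrow>
     W \<subseteq> V \<and> (\<forall>u\<in>V. \<exists>w\<in>W. u \<in> N w) \<and> (\<forall>w\<in>W. \<exists>p. private_child W w p)"

text \<open>\<open>V\<close> itself is a candidate because there are no sources, so one of least
  cardinality exists. If \<open>w\<close> had no private child, every child of \<open>w\<close>
  would have another parent in \<open>W\<close>, and \<open>W - {w}\<close> would be a smaller
  candidate.\<close>

lemma ex_minimal_total_dominating: "\<exists>W. minimal_total_dominating W"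
proof -
  let ?P = "\<lambda>W. W \<subseteq> V \<and> (\<forall>u\<in>V. \<exists>w\<in>W. u \<in> N w)"
  obtain W where W: "?P W" and min: "\<And>W'. ?P W' \<Longrightarrow> card W \<le> card W'"
    using ex_has_least_nat[of ?P V card] has_parent by auto
  have "\<exists>p. private_child W w p" if "w \<in> W" for w
  proof (rule ccontr)
    assume "\<nexists>p. private_child W w p"
    then have "?P (W - {w})" using W N_subset that unfolding private_child_def
      by (metis Diff_iff Diff_subset empty_iff insert_iff order_trans)
    then have "card W \<le> card (W - {w})" by (rule min)
    moreover have "finite W" using W finite_V finite_subset by blast
    ultimately show False using that by (metis card_Diff1_less leD)
  qed
  then show ?thesis using W unfolding minimal_total_dominating_def by blast
qed

section \<open>The greedy process\<close>

definition remaining :: "'a list \<Rightarrow> 'a set" where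
  "remaining vs = V - (\<Union>v\<in>set vs. insert v (N v))"

text \<open>The last disjunct makes the greedy process exhaust \<open>W\<close> before it turns to the other
  vertices.\<close>
inductive greedy :: "'a set \<Rightarrow> 'a list \<Rightarrow> bool" for W where
  Nil: "greedy W []"
| snoc: "greedy W vs \<Longrightarrow> v \<in> remaining vs \<Longrightarrow>
    (v \<in> W \<and> (\<forall>a \<in> remaining vs \<inter> W.
       card (N a \<inter> remaining vs - W) \<le> card (N v \<inter> remaining vs - W)))
    \<or> remaining vs \<inter> W = {} \<Longrightarrow>
    greedy W (vs @ [v])"

lemma remaining_snoc: "remaining (vs @ [v]) = remaining vs - insert v (N v)"
  by (auto simp: remaining_def)

lemma remaining_subset: "remaining vs \<subseteq> V"
  by (auto simp: remaining_def)

text \<open>A newly chosen vertex is still remaining, so it differs from all earlier choices and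
  lies outside their out-neighbourhoods.\<close>

lemma greedy_sorted:
  "greedy W vs \<Longrightarrow> sorted_wrt (\<lambda>u v. v \<notin> N u) vs \<and> distinct vs \<and> set vs \<subseteq> V"
  by (induction rule: greedy.induct) (auto simp: sorted_wrt_append remaining_def)

lemma finite_remaining: "finite (remaining vs)"
  using remaining_subset finite_V finite_subset by blast

lemma ex_greedy_exhaustive: "\<exists>vs. greedy W vs \<and> remaining vs = {}"
proof -
  have "\<exists>ws. greedy W ws \<and> remaining ws = {}" if "greedy W vs" for vs
    using that
  proof (induction "card (remaining vs)" arbitrary: vs rule: less_induct)
    case less
    show ?case
    proof (cases "remaining vs = {}")
      case True
      then show ?thesis using less by blast
    next
      case False
      \<comment> \<open>While \<open>W\<close> is not exhausted, a vertex with the maximal number of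
        children is eligible; afterwards every remaining vertex is.\<close>
      have "\<exists>v\<in>remaining vs. (v \<in> W \<and> (\<forall>a \<in> remaining vs \<inter> W.
         card (N a \<inter> remaining vs - W) \<le> card (N v \<inter> remaining vs - W))) \<or> remaining vs \<inter> W = {}"
      proof (cases "remaining vs \<inter> W = {}")
        case False
        then have "Max ((\<lambda>a. card (N a \<inter> remaining vs - W)) ` (remaining vs \<inter> W))
           \<in> (\<lambda>a. card (N a \<inter> remaining vs - W)) ` (remaining vs \<inter> W)"
          using finite_remaining by (intro Max_in) auto
        then obtain v where v: "v \<in> remaining vs \<inter> W"
          "card (N v \<inter> remaining vs - W) = Max ((\<lambda>a. card (N a \<inter> remaining vs - W)) ` (remaining vs \<inter> W))"
          by auto
        then show ?thesis using finite_remaining by (intro bexI[of _ v]) auto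
      qed (use False in auto)
      then obtain v where v: "v \<in> remaining vs" "greedy W (vs @ [v])"
        using greedy.snoc[OF less.prems] by blast
      moreover have "card (remaining (vs @ [v])) < card (remaining vs)"
        using v finite_remaining by (intro psubset_card_mono) (auto simp: remaining_snoc)
      ultimately show ?thesis using less.hyps by blast
    qed
  qed
  then show ?thesis using greedy.Nil by blast
qed

section \<open>Counting along the greedy process\<close>

abbreviation dominated :: "'a list \<Rightarrow> 'a set" where
  "dominated vs \<equiv> V - remaining vs - set vs"

text \<open>By the greedy choice, a dominated vertex of \<open>W\<close> has at most as many stranded children as the
  vertex that dominated it had remaining children outside \<open>W\<close>; this bounds the stranded vertices
  although they are dominated by no chosen vertex of \<open>W\<close>.\<close>
definition stranded :: "'a set \<Rightarrow> 'a list \<Rightarrow> 'a set" where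
  "stranded W vs = {u \<in> remaining vs - W. \<exists>a \<in> dominated vs \<inter> W. u \<in> N a}"

text \<open>\<open>Z\<close> collects the chosen vertices of \<open>W\<close> that had no remaining children. Their private children
  were themselves chosen earlier, so not both can belong to the kernel.\<close>
lemma greedy_bound:
  assumes W: "minimal_total_dominating W"
    and p: "\<And>w. w \<in> W \<Longrightarrow> private_child W w (p w)"
    and "greedy W vs"
  shows "\<exists>Z. Z \<subseteq> W \<inter> set vs \<and> p ` Z \<subseteq> set vs \<and>
     (set vs \<subseteq> W \<or> remaining vs \<inter> W = {}) \<and>
     8 * d * (card (V - remaining vs) + card (stranded W vs))
       \<le> (d + 2)\<^sup>2 * (2 * card (dominated vs) + card Z)"
  using assms(3)
\<comment> \<open>All weights are doubled in comparison with the block inequality: a dominated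
  vertex counts 2 and a vertex of \<open>Z\<close> counts 1, that is, as half a vertex kept out of
  the kernel.\<close>
proof (induction rule: greedy.induct)
  case Nil
  then show ?case by (auto simp: remaining_def stranded_def)
next
  case (snoc vs v)
  let ?M = "remaining vs" and ?vs = "vs @ [v]"
  let ?M' = "remaining ?vs"
  have M': "?M' = ?M - insert v (N v)" by (rule remaining_snoc)
  have vV: "v \<in> V" and vM: "v \<in> ?M" using snoc.hyps remaining_subset by auto
  have C: "set vs \<subseteq> V" using greedy_sorted snoc.hyps by blast
  have v_vs: "v \<notin> set vs" and vs_M: "set vs \<inter> ?M = {}" using vM by (auto simp: remaining_def)
  obtain Z where Z: "Z \<subseteq> W \<inter> set vs" "p ` Z \<subseteq> set vs"
    "set vs \<subseteq> W \<or> ?M \<inter> W = {}"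
    "8 * d * (card (V - ?M) + card (stranded W vs)) \<le> (d + 2)\<^sup>2 * (2 * card (dominated vs) + card Z)"
    using snoc.IH by blast
  have finZ: "finite Z" using Z(1) by (meson finite_Int finite_subset List.finite_set)
  have fin: "finite A" if "A \<subseteq> V" for A using that finite_V finite_subset by blast
  have MV: "?M \<subseteq> V" by (rule remaining_subset)
  have strandedM: "stranded W vs \<subseteq> ?M" by (auto simp: stranded_def)
  show ?case
  proof (cases "?M \<inter> W = {}")
    case True
    \<comment> \<open>A parent in \<open>W\<close> of a remaining vertex no longer remains, and it
      was not chosen, since then its child would have been deleted; hence it is dominated. So all of
      \<open>V\<close> is accounted for already, and the left-hand side cannot grow any
      more.\<close>
    have "?M \<subseteq> stranded W vs"
    proof
      fix u assume u: "u \<in> ?M"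
      then obtain a where a: "a \<in> W" "u \<in> N a" "a \<in> V"
        using W MV unfolding minimal_total_dominating_def by blast
      have "a \<notin> set vs" using u a by (auto simp: remaining_def)
      then show "u \<in> stranded W vs" using a u True by (auto simp: stranded_def)
    qed
    then have str: "stranded W vs = ?M" using strandedM by blast
    have "card (V - ?M') + card (stranded W ?vs) \<le> card (V - ?M') + card ?M'"
      by (intro add_left_mono card_mono) (auto simp: finite_remaining stranded_def)
    also have "\<dots> = card V" using finite_V remaining_subset[of ?vs]
      by (metis add.commute card_Diff_subset card_mono finite_remaining le_add_diff_inverse)
    also have "\<dots> = card (V - ?M) + card (stranded W vs)" unfolding str using finite_V MV
      by (metis add.commute card_Diff_subset card_mono finite_remaining le_add_diff_inverse)
    finally have "8 * d * (card (V - ?M') + card (stranded W ?vs)) \<le> (d + 2)\<^sup>2 * (2 * card (dominated vs) + card Z)"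
      using Z(4) by (meson le_trans mult_le_mono2)
    also have "\<dots> \<le> (d + 2)\<^sup>2 * (2 * card (dominated ?vs) + card Z)"
      using vM by (intro mult_le_mono2 add_mono mult_le_mono2 card_mono) (auto simp: M' finite_V finZ)
    finally show ?thesis using Z True by (intro exI[of _ Z]) (auto simp: M')
  next
    case False
    then have vW: "v \<in> W" and max: "\<And>a. a \<in> ?M \<inter> W \<Longrightarrow> card (N a \<inter> ?M - W) \<le> card (N v \<inter> ?M - W)"
      using snoc.hyps by auto
    have vsW: "set vs \<subseteq> W" using Z(3) False by blast
    define X where "X = N v \<inter> ?M - W"
    define Y where "Y = N v \<inter> ?M \<inter> W"
    have XY: "X \<union> Y = N v \<inter> ?M" "X \<inter> Y = {}" by (auto simp: X_def Y_def)
    have finX: "finite X" and finY: "finite Y" using MV by (auto simp: X_def Y_def intro!: fin)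
    have cXY: "card (N v \<inter> ?M) = card X + card Y"
      unfolding XY(1)[symmetric] using XY finX finY by (intro card_Un_disjoint)
    have le_d: "card X + card Y \<le> d"
      unfolding cXY[symmetric] using card_N[OF vV] finite_N[OF vV]
      by (meson Int_lower1 card_mono le_trans)
    have "V - ?M' = (V - ?M) \<union> insert v (N v \<inter> ?M)" using vM MV by (auto simp: M')
    then have "card (V - ?M') \<le> card (V - ?M) + card (insert v (N v \<inter> ?M))"
      by (simp only: card_Un_le)
    also have "card (insert v (N v \<inter> ?M)) = 1 + card X + card Y"
      using N_irrefl finite_remaining cXY by (simp add: card_insert_if)
    finally have c1: "card (V - ?M') \<le> card (V - ?M) + (1 + card X + card Y)" by simp
    have dom: "dominated ?vs = dominated vs \<union> (N v \<inter> ?M)" using vM vs_M MV N_irrefl by (auto simp: M')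
    \<comment> \<open>A newly stranded vertex has a parent in \<open>Y\<close>, and by the greedy
      choice of \<open>v\<close> each vertex of \<open>Y\<close> has at most \<open>card X\<close>
      remaining children outside \<open>W\<close>.\<close>
    have "stranded W ?vs \<subseteq> stranded W vs \<union> (\<Union>a\<in>Y. N a \<inter> ?M - W)"
      unfolding stranded_def dom by (auto simp: M' Y_def)
    then have "card (stranded W ?vs) \<le> card (stranded W vs \<union> (\<Union>a\<in>Y. N a \<inter> ?M - W))"
      using finite_remaining finY strandedM
      by (intro card_mono) (auto intro: finite_subset)
    also have "\<dots> \<le> card (stranded W vs) + card (\<Union>a\<in>Y. N a \<inter> ?M - W)"
      by (rule card_Un_le)
    also have "card (\<Union>a\<in>Y. N a \<inter> ?M - W) \<le> (\<Sum>a\<in>Y. card (N a \<inter> ?M - W))"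
      by (rule card_UN_le[OF finY])
    also have "(\<Sum>a\<in>Y. card (N a \<inter> ?M - W)) \<le> (\<Sum>a\<in>Y. card X)"
      unfolding X_def by (intro sum_mono max) (auto simp: Y_def)
    finally have c2: "card (stranded W ?vs) \<le> card (stranded W vs) + card X * card Y" by (simp add: mult.commute)
    have "card (dominated ?vs) = card (dominated vs) + card (N v \<inter> ?M)"
      unfolding dom using finite_V finite_remaining by (intro card_Un_disjoint) auto
    then have c3: "card (dominated ?vs) = card (dominated vs) + (card X + card Y)" by (simp add: cXY)
    \<comment> \<open>With \<open>x = card X\<close> and \<open>y = card Y\<close>, at most
      \<open>1 + x + y\<close> vertices are newly deleted and at most \<open>x y\<close> newly
      stranded.\<close>
    have "card (V - ?M') + card (stranded W ?vs)
       \<le> (card (V - ?M) + card (stranded W vs)) + (1 + card X) * (1 + card Y)"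
      using c1 c2 by (simp add: algebra_simps)
    then have "8 * d * (card (V - ?M') + card (stranded W ?vs))
       \<le> 8 * d * ((card (V - ?M) + card (stranded W vs)) + (1 + card X) * (1 + card Y))"
      by (rule mult_le_mono2)
    also have "\<dots> = 8 * d * (card (V - ?M) + card (stranded W vs)) + 2 * (4 * d * ((1 + card X) * (1 + card Y)))"
      by (simp add: algebra_simps)
    also have "\<dots> \<le> (d + 2)\<^sup>2 * (2 * card (dominated vs) + card Z) + 2 * (4 * d * ((1 + card X) * (1 + card Y)))"
      using Z(4) by simp
    finally have bound: "8 * d * (card (V - ?M') + card (stranded W ?vs))
      \<le> (d + 2)\<^sup>2 * (2 * card (dominated vs) + card Z) + 2 * (4 * d * ((1 + card X) * (1 + card Y)))" .
    show ?thesis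
    proof (cases "card X + card Y = 0")
      case True
      then have "N v \<inter> ?M = {}" using cXY finite_remaining by auto
      moreover have pv: "p v \<in> N v" "\<And>w. w \<in> W \<Longrightarrow> p v \<in> N w \<Longrightarrow> w = v"
        using p[OF vW] by (auto simp: private_child_def)
      moreover have "p v \<in> V" using pv N_subset vV by blast
      \<comment> \<open>\<open>p v\<close> no longer remains, but it was not deleted as a child: all
        earlier choices lie in \<open>W\<close>, where \<open>v\<close> is its only parent. So it
        was itself chosen.\<close>
      ultimately have "p v \<in> set vs" using vsW v_vs by (fastforce simp: remaining_def)
      moreover have "card (insert v Z) = card Z + 1"
        using Z(1) v_vs finZ by (auto simp: card_insert_if)
      \<comment> \<open>The block consists of \<open>v\<close> alone and is paid for by the unit of
        weight that \<open>v\<close> contributes to \<open>Z\<close>.\<close>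
      moreover have "2 * (4 * d) \<le> (d + 2)\<^sup>2"
      proof -
        have "0 \<le> (int d - 2)\<^sup>2" by simp
        then have "int (2 * (4 * d)) \<le> int ((d + 2)\<^sup>2)"
          by (simp add: power2_eq_square algebra_simps)
        then show ?thesis by (simp only: of_nat_le_iff)
      qed
      ultimately show ?thesis using Z vW vsW bound True c3
        by (intro exI[of _ "insert v Z"]) (auto simp: algebra_simps)
    next
      case nz: False
      have "2 * (4 * d * ((1 + card X) * (1 + card Y))) \<le> 2 * ((card X + card Y) * (d + 2)\<^sup>2)"
        using nz le_d two_le_d by (intro mult_le_mono2 block_bound) auto
      with bound have "8 * d * (card (V - ?M') + card (stranded W ?vs))
         \<le> (d + 2)\<^sup>2 * (2 * card (dominated ?vs) + card Z)"
        unfolding c3 by (simp add: algebra_simps)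
      then show ?thesis using Z vW vsW by (intro exI[of _ Z]) auto
    qed
  qed
qed

text \<open>\<open>V\<close> splits into the dominated vertices, the chosen vertices outside the
  kernel, and the kernel. For \<open>w \<in> Z\<close> the arc from \<open>w\<close> to
  \<open>p w\<close> joins two chosen vertices, so one of them is outside the kernel; as
  \<open>p\<close> is injective on \<open>Z\<close>, \<open>card Z\<close> is at most twice the
  number of such vertices. Then \<open>4 d card V\<close> is at most \<open>(d + 2)^2\<close> times
  the size of the complement of the kernel, and \<open>(d + 2)^2 - 4 d = d^2 + 4\<close>.\<close>

lemma card_list_kernel_greedy:
  assumes W: "minimal_total_dominating W" and gr: "greedy W vs" and rem: "remaining vs = {}"
  shows "(d + 2)\<^sup>2 * card (list_kernel N vs) \<le> (d\<^sup>2 + 4) * card V"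
proof -
  let ?S = "list_kernel N vs"
  obtain p where p: "\<And>w. w \<in> W \<Longrightarrow> private_child W w (p w)"
    using W unfolding minimal_total_dominating_def by metis
  obtain Z where Z: "Z \<subseteq> W \<inter> set vs" "p ` Z \<subseteq> set vs"
    "8 * d * (card V + card (stranded W vs)) \<le> (d + 2)\<^sup>2 * (2 * card (V - set vs) + card Z)"
    using greedy_bound[OF W p gr] rem by auto
  have vs: "sorted_wrt (\<lambda>u v. v \<notin> N u) vs" "set vs \<subseteq> V" using greedy_sorted[OF gr] by auto
  have S: "?S \<subseteq> set vs" by (rule list_kernel_subset)
  let ?K = "set vs - ?S"
  have finZ: "finite Z" using Z finite_subset by blast
  have inj: "inj_on p Z"
  proof (rule inj_onI)
    fix w w' assume "w \<in> Z" "w' \<in> Z" "p w = p w'"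
    then show "w = w'" using p Z(1) unfolding private_child_def by (metis IntD1 subsetD)
  qed
  have "Z \<subseteq> ?K \<union> {w \<in> Z. p w \<in> ?K}"
  proof
    fix w assume w: "w \<in> Z"
    then have "p w \<in> N w" using p Z(1) by (auto simp: private_child_def)
    then have "w \<notin> ?S \<or> p w \<notin> ?S"
      using list_kernel_independent[OF N_irrefl vs(1)] by blast
    then show "w \<in> ?K \<union> {w \<in> Z. p w \<in> ?K}" using w Z by blast
  qed
  then have "card Z \<le> card (?K \<union> {w \<in> Z. p w \<in> ?K})" using finZ by (intro card_mono) auto
  also have "\<dots> \<le> card ?K + card {w \<in> Z. p w \<in> ?K}" by (rule card_Un_le)
  also have "card {w \<in> Z. p w \<in> ?K} \<le> card ?K"
    using inj by (intro card_inj_on_le[of p]) (auto simp: inj_on_def)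
  finally have cZ: "card Z \<le> 2 * card ?K" by simp
  have "card V = card (V - set vs) + card (set vs)"
    using vs(2) finite_V by (metis card_Diff_subset card_mono List.finite_set le_add_diff_inverse2)
  also have "card (set vs) = card ?K + card ?S"
    using S by (metis card_Diff_subset card_mono finite_subset List.finite_set le_add_diff_inverse2)
  finally have cV: "card V = card (V - set vs) + card ?K + card ?S" by simp
  have "8 * d * card V \<le> (d + 2)\<^sup>2 * (2 * card (V - set vs) + card Z)"
    using Z(3) by (meson le_add1 le_trans mult_le_mono2)
  also have "\<dots> \<le> (d + 2)\<^sup>2 * (2 * card (V - set vs) + 2 * card ?K)"
    using cZ by simp
  finally have "8 * d * card V + 2 * (d + 2)\<^sup>2 * card ?S \<le> 2 * (d + 2)\<^sup>2 * card V"
    unfolding cV by (simp add: algebra_simps)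
  then show ?thesis by (simp add: power2_eq_square algebra_simps)
qed

text \<open>Each vertex is chosen or a child of a chosen vertex, which in turn is in the kernel or a
  child of a kernel vertex.\<close>

lemma list_kernel_two_dominates:
  assumes "remaining vs = {}" "u \<in> V"
  shows "\<exists>v\<in>list_kernel N vs. u = v \<or> u \<in> N v \<or> (\<exists>w. w \<in> N v \<and> u \<in> N w)"
proof -
  obtain w where w: "w \<in> set vs" "u = w \<or> u \<in> N w" using assms by (auto simp: remaining_def)
  then show ?thesis using list_kernel_dominates[of w vs N] by blast
qed

end

section \<open>Timed execution\<close>

text \<open>A total-correctness assertion in which \<open>t\<close> is only an upper bound, so that
  branches and iterations of different cost can share one bound.\<close>

definition runs :: "com \<Rightarrow> memory \<Rightarrow> nat \<Rightarrow> (memory \<Rightarrow> bool) \<Rightarrow> bool" where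
  "runs c s t P \<longleftrightarrow> (\<exists>t' s'. exec c s t' s' \<and> t' \<le> t \<and> P s')"

lemma runs_Skip: "P s \<Longrightarrow> runs Skip s 1 P"
  unfolding runs_def using exec.Skip by blast

lemma runs_Assign:
  "P (update_cell s x (aval a s) (aval b s) (aval e s)) \<Longrightarrow>
   runs (Assign x a b e) s (1 + acost a + acost b + acost e) P"
  unfolding runs_def using exec.Assign by blast

lemma runs_Seq:
  assumes "runs c\<^sub>1 s t\<^sub>1 P" "\<And>s'. P s' \<Longrightarrow> runs c\<^sub>2 s' t\<^sub>2 Q"
  shows "runs (Seq c\<^sub>1 c\<^sub>2) s (t\<^sub>1 + t\<^sub>2) Q"
  using assms unfolding runs_def by (meson add_mono exec.Seq)

lemma runs_Cond:
  assumes "bval b s \<Longrightarrow> runs c\<^sub>1 s t\<^sub>1 P" "\<not> bval b s \<Longrightarrow> runs c\<^sub>2 s t\<^sub>2 P"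
  shows "runs (Cond b c\<^sub>1 c\<^sub>2) s (1 + bcost b + (t\<^sub>1 + t\<^sub>2)) P"
proof (cases "bval b s")
  case True
  with assms(1) obtain t' s' where "exec c\<^sub>1 s t' s'" "t' \<le> t\<^sub>1" "P s'" unfolding runs_def by blast
  then show ?thesis unfolding runs_def using exec.CondTrue[OF True]
    by (meson add_le_mono order_refl trans_le_add1)
next
  case False
  with assms(2) obtain t' s' where "exec c\<^sub>2 s t' s'" "t' \<le> t\<^sub>2" "P s'" unfolding runs_def by blast
  then show ?thesis unfolding runs_def using exec.CondFalse[OF False]
    by (meson add_le_mono order_refl trans_le_add2)
qed

lemma runs_weaken:
  assumes "runs c s t P" "\<And>s'. P s' \<Longrightarrow> Q s'" "t \<le> t'"
  shows "runs c s t' Q"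
  using assms unfolding runs_def by (meson le_trans)

lemma runs_le: "runs c s t P \<Longrightarrow> t \<le> t' \<Longrightarrow> runs c s t' P"
  by (rule runs_weaken)

text \<open>With a \<open>runs\<close> assertion as intermediate condition the rules can be chained,
  the state after an assignment being computed instead of described.\<close>

lemma runs_Seq_nested:
  "runs c\<^sub>1 s t\<^sub>1 (\<lambda>s'. runs c\<^sub>2 s' t\<^sub>2 Q) \<Longrightarrow> runs (Seq c\<^sub>1 c\<^sub>2) s (t\<^sub>1 + t\<^sub>2) Q"
  by (rule runs_Seq)

primrec loop_free :: "com \<Rightarrow> bool" where
  "loop_free Skip \<longleftrightarrow> True"
| "loop_free (Assign x a b e) \<longleftrightarrow> True"
| "loop_free (Seq c\<^sub>1 c\<^sub>2) \<longleftrightarrow> loop_free c\<^sub>1 \<and> loop_free c\<^sub>2"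
| "loop_free (Cond b c\<^sub>1 c\<^sub>2) \<longleftrightarrow> loop_free c\<^sub>1 \<and> loop_free c\<^sub>2"
| "loop_free (While b c) \<longleftrightarrow> False"

text \<open>Outcome and cost of loop-free programs; the equations for loops are dummies.\<close>
primrec outcome :: "com \<Rightarrow> memory \<Rightarrow> memory" where
  "outcome Skip s = s"
| "outcome (Assign x a b e) s = update_cell s x (aval a s) (aval b s) (aval e s)"
| "outcome (Seq c\<^sub>1 c\<^sub>2) s = outcome c\<^sub>2 (outcome c\<^sub>1 s)"
| "outcome (Cond b c\<^sub>1 c\<^sub>2) s = (if bval b s then outcome c\<^sub>1 s else outcome c\<^sub>2 s)"
| "outcome (While b c) s = s"

primrec ccost :: "com \<Rightarrow> nat" where
  "ccost Skip = 1"
| "ccost (Assign x a b e) = 1 + acost a + acost b + acost e"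
| "ccost (Seq c\<^sub>1 c\<^sub>2) = ccost c\<^sub>1 + ccost c\<^sub>2"
| "ccost (Cond b c\<^sub>1 c\<^sub>2) = 1 + bcost b + (ccost c\<^sub>1 + ccost c\<^sub>2)"
| "ccost (While b c) = 0"

lemma runs_loop_free:
  assumes "loop_free c" "P (outcome c s)"
  shows "runs c s (ccost c) P"
proof -
  have "runs c s (ccost c) (\<lambda>s'. s' = outcome c s)"
    using assms(1)
  proof (induction c arbitrary: s)
    case Skip
    show ?case by (simp add: runs_Skip[simplified])
  next
    case (Assign x a b e)
    show ?case using runs_Assign[of "\<lambda>s'. s' = outcome (Assign x a b e) s"] by simp
  next
    case (Seq c\<^sub>1 c\<^sub>2)
    then show ?case by (auto intro: runs_Seq)
  next
    case (Cond b c\<^sub>1 c\<^sub>2)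
    have "runs (Cond b c\<^sub>1 c\<^sub>2) s (1 + bcost b + (ccost c\<^sub>1 + ccost c\<^sub>2))
       (\<lambda>s'. s' = outcome (Cond b c\<^sub>1 c\<^sub>2) s)"
      using Cond by (intro runs_Cond) auto
    then show ?case by simp
  qed simp
  then show ?thesis by (rule runs_weaken) (use assms in auto)
qed

lemma runs_loop_free_le:
  "loop_free c \<Longrightarrow> ccost c \<le> t \<Longrightarrow> P (outcome c s) \<Longrightarrow> runs c s t P"
  by (rule runs_le[OF runs_loop_free])

abbreviation var :: "tname \<Rightarrow> aexp" where
  "var x \<equiv> Cell x (Const 0) (Const 0)"

abbreviation arr :: "tname \<Rightarrow> aexp \<Rightarrow> aexp" where
  "arr x a \<equiv> Cell x (Const 0) a"

abbreviation set_var :: "tname \<Rightarrow> aexp \<Rightarrow> com" where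
  "set_var x e \<equiv> Assign x (Const 0) (Const 0) e"

abbreviation set_arr :: "tname \<Rightarrow> aexp \<Rightarrow> aexp \<Rightarrow> com" where
  "set_arr x a e \<equiv> Assign x (Const 0) a e"

definition For :: "tname \<Rightarrow> aexp \<Rightarrow> com \<Rightarrow> com" where
  "For i e c = Seq (set_var i (Const 0))
     (While (Less (var i) e) (Seq c (set_var i (Plus (var i) (Const 1)))))"

lemma update_cell_same:
  "update_cell s x i j k x a b = (if a = i \<and> b = j then k else s x a b)"
  by (simp add: update_cell_def)

lemma update_cell_other: "y \<noteq> x \<Longrightarrow> update_cell s x i j k y = s y"
  by (simp add: update_cell_def)

text \<open>The invariant has to tolerate any change of the counter cell, so the number of completed
  rounds is passed separately as \<open>k\<close>. The loop bound is evaluated anew in every test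
  and must therefore follow from the invariant.\<close>

lemma runs_For:
  assumes init: "I 0 s"
    and upd: "\<And>k s' m. I k s' \<Longrightarrow> I k (update_cell s' i 0 0 m)"
    and bound: "\<And>k s'. I k s' \<Longrightarrow> aval e s' = N"
    and body: "\<And>k s'. k < N \<Longrightarrow> I k s' \<Longrightarrow> s' i 0 0 = k \<Longrightarrow>
      runs c s' t (\<lambda>s''. s'' i 0 0 = k \<and> I (Suc k) s'')"
  shows "runs (For i e c) s (N * (t + acost e + 13) + acost e + 9) (I N)"
proof -
  let ?w = "While (Less (var i) e) (Seq c (set_var i (Plus (var i) (Const 1))))"
  \<comment> \<open>Besides the body, a round costs \<open>acost e + 5\<close> for the test and 8
    for the increment. The final test, together with the initial assignment of cost 4, gives the
    remaining \<open>acost e + 9\<close>.\<close>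
  have "runs ?w s' (n * (t + acost e + 13) + acost e + 5) (I N)"
    if "I k s'" "s' i 0 0 = k" "k + n = N" for n k s'
    using that
  proof (induction n arbitrary: k s')
    case 0
    then have "\<not> bval (Less (var i) e) s'" using bound by simp
    from exec.WhileFalse[OF this] show ?case using 0 unfolding runs_def by fastforce
  next
    case (Suc n)
    then have b: "bval (Less (var i) e) s'" using bound by simp
    obtain t1 s1 where s1: "exec c s' t1 s1" "t1 \<le> t" "s1 i 0 0 = k" "I (Suc k) s1"
      using body[of k s'] Suc.prems unfolding runs_def by auto
    let ?s2 = "update_cell s1 i 0 0 (Suc k)"
    have "exec (set_var i (Plus (var i) (Const 1))) s1 8 ?s2"
      using exec.Assign[of i "Const 0" "Const 0" "Plus (var i) (Const 1)" s1] s1(3) by (simp add: numeral_eq_Suc)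
    then have ex: "exec (Seq c (set_var i (Plus (var i) (Const 1)))) s' (t1 + 8) ?s2"
      using s1(1) exec.Seq by blast
    have "runs ?w ?s2 (n * (t + acost e + 13) + acost e + 5) (I N)"
    proof (rule Suc.IH)
      show "I (Suc k) ?s2" by (rule upd[OF s1(4)])
    qed (use Suc.prems in \<open>auto simp: update_cell_same\<close>)
    then obtain t3 s3 where s3: "exec ?w ?s2 t3 s3"
      "t3 \<le> n * (t + acost e + 13) + acost e + 5" "I N s3"
      unfolding runs_def by blast
    show ?case unfolding runs_def
      using exec.WhileTrue[OF b ex s3(1)] s1(2) s3(2,3) by fastforce
  qed
  from this[OF upd[OF init], of 0 N]
  have "runs ?w (update_cell s i 0 0 0) (N * (t + acost e + 13) + acost e + 5) (I N)"
    by (simp add: update_cell_def)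
  then show ?thesis unfolding runs_def For_def
    using exec.Seq[OF exec.Assign[of i "Const 0" "Const 0" "Const 0" s]] by fastforce
qed

definition Foreach :: "tname \<Rightarrow> aexp \<Rightarrow> tname \<Rightarrow> aexp \<Rightarrow> com \<Rightarrow> com" where
  "Foreach i e x a c = For i e (Seq (set_var x a) c)"

text \<open>The invariant depends on the set of visited elements and not on the unspecified order of
  the enumeration; injectivity of \<open>g\<close> makes the current element new.\<close>

lemma runs_Foreach:
  assumes bij: "bij_betw g {..<N} A"
    and init: "J {} s"
    and upd: "\<And>B s' m. J B s' \<Longrightarrow> J B (update_cell s' i 0 0 m) \<and> J B (update_cell s' x 0 0 m)"
    and bound: "\<And>B s'. J B s' \<Longrightarrow> aval e s' = N"
    and get: "\<And>B s'. J B s' \<Longrightarrow> s' i 0 0 < N \<Longrightarrow> aval a s' = g (s' i 0 0)"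
    and "x \<noteq> i"
    and body: "\<And>B s'. B \<subseteq> A \<Longrightarrow> s' x 0 0 \<in> A - B \<Longrightarrow> J B s' \<Longrightarrow>
      runs c s' t (\<lambda>s''. s'' i = s' i \<and> J (insert (s' x 0 0) B) s'')"
  shows "runs (Foreach i e x a c) s (N * (t + acost a + acost e + 16) + acost e + 9) (J A)"
proof -
  have "runs (For i e (Seq (set_var x a) c)) s
      (N * ((1 + acost (Const 0) + acost (Const 0) + acost a + t) + acost e + 13) + acost e + 9)
      (J (g ` {..<N}))"
  proof (rule runs_For[where I = "\<lambda>k. J (g ` {..<k})"])
    fix k s' assume k: "k < N" "J (g ` {..<k}) s'" "s' i 0 0 = k"
    let ?s = "update_cell s' x 0 0 (g k)"
    have "g k \<in> A - g ` {..<k}" "g ` {..<k} \<subseteq> A"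
      using bij k(1) unfolding bij_betw_def inj_on_def by fastforce+
    moreover have "J (g ` {..<k}) ?s" using upd k by blast
    ultimately have "runs c ?s t (\<lambda>s''. s'' i = ?s i \<and> J (insert (?s x 0 0) (g ` {..<k})) s'')"
      by (intro body) (auto simp: update_cell_same)
    then have r: "runs c ?s t (\<lambda>s''. s'' i 0 0 = k \<and> J (g ` {..<Suc k}) s'')"
      using k(3) \<open>x \<noteq> i\<close>
      by (elim runs_weaken) (auto simp: update_cell_same update_cell_other lessThan_Suc)
    show "runs (Seq (set_var x a) c) s' (1 + acost (Const 0) + acost (Const 0) + acost a + t)
        (\<lambda>s''. s'' i 0 0 = k \<and> J (g ` {..<Suc k}) s'')"
      using get[OF k(2)] k r by (intro runs_Seq[where P = "\<lambda>s1. s1 = ?s"] runs_Assign) auto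
  qed (use init upd bound in auto)
  moreover have "g ` {..<N} = A" using bij by (auto simp: bij_betw_def)
  ultimately show ?thesis unfolding Foreach_def by (simp add: algebra_simps)
qed

section \<open>Frame conditions: which tables may change\<close>

definition agree :: "tname set \<Rightarrow> memory \<Rightarrow> memory \<Rightarrow> bool" where
  "agree F s s' \<longleftrightarrow> (\<forall>x. x \<notin> F \<longrightarrow> s' x = s x)"

lemma agree_refl: "agree F s s"
  by (simp add: agree_def)

lemma agree_update: "agree F s s' \<Longrightarrow> x \<in> F \<Longrightarrow> agree F s (update_cell s' x i j k)"
  by (auto simp: agree_def update_cell_def)

lemma agree_trans: "agree F s s' \<Longrightarrow> agree G s' s'' \<Longrightarrow> G \<subseteq> F \<Longrightarrow> agree F s s''"
  by (auto simp: agree_def)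

lemma agreeD: "agree F s s' \<Longrightarrow> x \<notin> F \<Longrightarrow> s' x = s x"
  by (simp add: agree_def)

section \<open>A quadratic-time program\<close>

text \<open>Nonzero entries mark the vertices discarded from \<open>W\<close> in \<open>X\<close>, the vertices that are no longer
  remaining in \<open>G\<close>, and the vertices dominated by the kernel in \<open>K\<close>; \<open>T\<close> with length \<open>m\<close> is the list
  of chosen vertices. The greedy key is \<open>1\<close> outside \<open>W\<close> and at least \<open>2\<close> in \<open>W\<close>, so that \<open>W\<close> is
  exhausted first, and \<open>best = 0\<close> signals that no vertex remains.\<close>

definition other_parent_prog :: com where
  "other_parent_prog =
     Seq (set_var ''f'' (Const 0))
       (Foreach ''k'' (var ''n'') ''y'' (arr ''V'' (var ''k''))
         (Cond (Conj (Less (arr ''X'' (var ''y'')) (Const 1))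
                 (Conj (Less (Const 0) (Cell ''arc'' (var ''y'') (var ''u'')))
                   (Neg (Conj (Neg (Less (var ''y'') (var ''v''))) (Neg (Less (var ''v'') (var ''y'')))))))
           (set_var ''f'' (Const 1)) Skip))"

definition private_child_prog :: com where
  "private_child_prog =
     Seq (set_var ''b'' (Const 0))
       (Foreach ''j'' (arr ''outdeg'' (var ''v'')) ''u'' (Cell ''out'' (var ''v'') (var ''j''))
         (Seq other_parent_prog (Cond (Less (var ''f'') (Const 1)) (set_var ''b'' (Const 1)) Skip)))"

definition total_dominating_prog :: com where
  "total_dominating_prog =
     Foreach ''i'' (var ''n'') ''v'' (arr ''V'' (var ''i''))
       (Seq private_child_prog
         (Cond (Less (var ''b'') (Const 1)) (set_arr ''X'' (var ''v'') (Const 1)) Skip))"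

definition count_prog :: com where
  "count_prog =
     Seq (set_var ''key'' (Const 2))
       (Foreach ''j'' (arr ''outdeg'' (var ''v'')) ''u'' (Cell ''out'' (var ''v'') (var ''j''))
         (Cond (Conj (Less (arr ''G'' (var ''u'')) (Const 1)) (Less (Const 0) (arr ''X'' (var ''u''))))
           (set_var ''key'' (Plus (var ''key'') (Const 1))) Skip))"

definition key_prog :: com where
  "key_prog = Cond (Less (arr ''X'' (var ''v'')) (Const 1)) count_prog (set_var ''key'' (Const 1))"

definition best_prog :: com where
  "best_prog =
     Seq (set_var ''best'' (Const 0))
       (Foreach ''i'' (var ''n'') ''v'' (arr ''V'' (var ''i''))
         (Cond (Less (arr ''G'' (var ''v'')) (Const 1))
           (Seq key_prog
             (Cond (Less (var ''best'') (var ''key''))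
               (Seq (set_var ''best'' (var ''key'')) (set_var ''w'' (var ''v''))) Skip))
           Skip))"

definition remove_prog :: com where
  "remove_prog =
     Seq (set_arr ''T'' (var ''m'') (var ''w''))
       (Seq (set_var ''m'' (Plus (var ''m'') (Const 1)))
         (Seq (set_arr ''G'' (var ''w'') (Const 1))
           (Foreach ''j'' (arr ''outdeg'' (var ''w'')) ''u'' (Cell ''out'' (var ''w'') (var ''j''))
             (set_arr ''G'' (var ''u'') (Const 1)))))"

text \<open>Every round chooses a vertex until none remains, so as many rounds as vertices suffice;
  surplus rounds leave the list unchanged.\<close>

definition greedy_prog :: com where
  "greedy_prog =
     For ''t'' (var ''n'')
       (Seq best_prog (Cond (Less (Const 0) (var ''best'')) remove_prog Skip))"

definition insert_prog :: com where
  "insert_prog =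
     Seq (set_arr ''Q'' (var ''v'') (Const 1))
       (Foreach ''j'' (arr ''outdeg'' (var ''v'')) ''u'' (Cell ''out'' (var ''v'') (var ''j''))
         (set_arr ''K'' (var ''u'') (Const 1)))"

text \<open>The list is read backwards because \<open>list_kernel\<close> decides about the head
  after the tail.\<close>

definition kernel_prog :: com where
  "kernel_prog =
     For ''i'' (var ''m'')
       (Seq (set_var ''v'' (arr ''T'' (Minus (var ''m'') (Plus (var ''i'') (Const 1)))))
         (Cond (Less (arr ''K'' (var ''v'')) (Const 1)) insert_prog Skip))"

definition quasi_kernel_prog :: com where
  "quasi_kernel_prog = Seq total_dominating_prog (Seq greedy_prog kernel_prog)"

abbreviation inputs :: "tname set" where
  "inputs \<equiv> {''n'', ''V'', ''outdeg'', ''out'', ''arc''}"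

text \<open>One summand for each of the three phases, in the form that the loop rules yield.\<close>

definition time_bound :: "nat \<Rightarrow> nat \<Rightarrow> nat" where
  "time_bound d n =
     (n * (d * (n * 74 + 64) + 62) + 12) +
     ((n * (n * (d * 58 + 100) + d * 34 + 80) + 12) + (n * (d * 34 + 60) + 12))"

section \<open>Correctness and cost of the phases\<close>

locale nat_out_nbhds = out_nbhds V N d for V :: "nat set" and N d
begin

definition input :: "memory \<Rightarrow> bool" where
  "input s \<longleftrightarrow> s ''n'' 0 0 = card V \<and> bij_betw (s ''V'' 0) {..<card V} V \<and>
     (\<forall>v\<in>V. s ''outdeg'' 0 v = card (N v) \<and> bij_betw (s ''out'' v) {..<card (N v)} (N v)) \<and>
     (\<forall>u\<in>V. \<forall>v. s ''arc'' u v = (if v \<in> N u then 1 else 0))"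

lemma input_agree: "input s \<Longrightarrow> agree F s s' \<Longrightarrow> F \<inter> inputs = {} \<Longrightarrow> input s'"
  by (auto simp: input_def agree_def)

lemma runs_foreach_vertex:
  assumes s: "input s" "i \<notin> inputs" "x \<notin> inputs" "x \<noteq> i"
    and init: "J {} s"
    and upd: "\<And>B s' m. J B s' \<Longrightarrow> J B (update_cell s' i 0 0 m) \<and> J B (update_cell s' x 0 0 m)"
    and J: "\<And>B s'. J B s' \<Longrightarrow> agree F s s'" "F \<inter> inputs = {}"
    and body: "\<And>B s'. B \<subseteq> V \<Longrightarrow> s' x 0 0 \<in> V - B \<Longrightarrow> J B s' \<Longrightarrow>
      runs c s' t (\<lambda>s''. s'' i = s' i \<and> J (insert (s' x 0 0) B) s'')"
  shows "runs (Foreach i (var ''n'') x (arr ''V'' (var i)) c) s (card V * (t + 24) + 12) (J V)"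
proof -
  have "runs (Foreach i (var ''n'') x (arr ''V'' (var i)) c) s
     (card V * (t + acost (arr ''V'' (var i)) + acost (var ''n'') + 16) + acost (var ''n'') + 9) (J V)"
  proof (rule runs_Foreach[where g = "s ''V'' 0" and J = J])
    show "bij_betw (s ''V'' 0) {..<card V} V" using s by (simp add: input_def)
    fix B s' assume a: "J B s'"
    have "input s'" by (rule input_agree[OF s(1) J(1)[OF a] J(2)])
    then show "aval (var ''n'') s' = card V" by (simp add: input_def)
    show "aval (arr ''V'' (var i)) s' = s ''V'' 0 (s' i 0 0)"
      using agreeD[OF J(1)[OF a], of "''V''"] J(2) by simp
  qed (fact init upd s(4) body)+
  then show ?thesis by (rule runs_weaken) auto
qed

text \<open>The number of rounds \<open>card (N v)\<close> is replaced by its bound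
  \<open>d\<close>; this keeps the nested loops quadratic for fixed \<open>d\<close>.\<close>

lemma runs_foreach_child:
  assumes s: "input s" "v \<in> V" "s vx 0 0 = v" "j \<notin> insert vx inputs" "x \<notin> insert vx inputs" "x \<noteq> j"
    and init: "J {} s"
    and upd: "\<And>B s' m. J B s' \<Longrightarrow> J B (update_cell s' j 0 0 m) \<and> J B (update_cell s' x 0 0 m)"
    and J: "\<And>B s'. J B s' \<Longrightarrow> agree F s s'" "F \<inter> insert vx inputs = {}"
    and body: "\<And>B s'. B \<subseteq> N v \<Longrightarrow> s' x 0 0 \<in> N v - B \<Longrightarrow> J B s' \<Longrightarrow>
      runs c s' t (\<lambda>s''. s'' j = s' j \<and> J (insert (s' x 0 0) B) s'')"
  shows "runs (Foreach j (arr ''outdeg'' (var vx)) x (Cell ''out'' (var vx) (var j)) c) s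
     (d * (t + 28) + 14) (J (N v))"
proof -
  have "runs (Foreach j (arr ''outdeg'' (var vx)) x (Cell ''out'' (var vx) (var j)) c) s
     (card (N v) * (t + acost (Cell ''out'' (var vx) (var j)) + acost (arr ''outdeg'' (var vx)) + 16)
       + acost (arr ''outdeg'' (var vx)) + 9) (J (N v))"
  proof (rule runs_Foreach[where g = "s ''out'' v" and J = J])
    show "bij_betw (s ''out'' v) {..<card (N v)} (N v)" using s by (simp add: input_def)
    fix B s' assume a: "J B s'"
    have eq: "s' y = s y" if "y \<in> insert vx inputs" for y
      using agreeD[OF J(1)[OF a], of y] J(2) that by blast
    then show "aval (arr ''outdeg'' (var vx)) s' = card (N v)" "aval (Cell ''out'' (var vx) (var j)) s' = s ''out'' v (s' j 0 0)"
      using s by (simp_all add: input_def)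
  qed (fact init upd s(6) body)+
  then show ?thesis by (rule runs_weaken) (auto simp: add.commute card_N[OF s(2)])
qed

text \<open>The two negated comparisons in the program amount to \<open>y \<noteq> v\<close>, so the
  flag \<open>f\<close> tells whether \<open>u\<close> keeps a parent when \<open>v\<close> is
  discarded.\<close>

lemma runs_other_parent:
  assumes s: "input s" "s ''u'' 0 0 = u" "s ''v'' 0 0 = v"
  shows "runs other_parent_prog s (card V * 74 + 16) (\<lambda>s'. agree {''f'', ''k'', ''y''} s s' \<and>
     (s' ''f'' 0 0 \<noteq> 0 \<longleftrightarrow> (\<exists>y\<in>V. s ''X'' 0 y = 0 \<and> u \<in> N y \<and> y \<noteq> v)))"
proof -
  let ?F = "{''f'', ''k'', ''y''}"
  let ?J = "\<lambda>B s'. agree ?F s s' \<and>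
    (s' ''f'' 0 0 \<noteq> 0 \<longleftrightarrow> (\<exists>y\<in>B. s ''X'' 0 y = 0 \<and> u \<in> N y \<and> y \<noteq> v))"
  show ?thesis unfolding other_parent_prog_def
  proof (rule runs_le, rule runs_Seq_nested, rule runs_Assign,
      rule runs_foreach_vertex[where J = ?J and F = ?F and t = 50], goal_cases)
    case 1
    show ?case by (rule input_agree[OF s(1) agree_update[OF agree_refl, of _ ?F]]) auto
  next
    case (7 B s')
    then show ?case by (auto simp: agree_def update_cell_other)
  next
    case (9 B s')
    let ?y = "s' ''y'' 0 0"
    have eq: "s' ''X'' = s ''X''" "s' ''u'' = s ''u''" "s' ''v'' = s ''v''" "s' ''arc'' = s ''arc''"
      using 9(3) by (simp_all add: agree_def)
    have "?y \<in> V" using 9(2) by simp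
    then have "s ''arc'' ?y u = (if u \<in> N ?y then 1 else 0)" using s(1) by (simp add: input_def)
    then show ?case using 9(3)
      by (intro runs_loop_free_le) (auto simp: eq s agree_update update_cell_same update_cell_other)
  qed (auto simp: agree_refl agree_update update_cell_same update_cell_other)
qed

lemma runs_private_child:
  assumes s: "input s" "s ''v'' 0 0 = v" "v \<in> V"
  shows "runs private_child_prog s (d * (card V * 74 + 64) + 18) (\<lambda>s'.
     agree {''b'', ''j'', ''u'', ''f'', ''k'', ''y''} s s' \<and>
     (s' ''b'' 0 0 \<noteq> 0 \<longleftrightarrow> (\<exists>u\<in>N v. \<forall>y\<in>V. s ''X'' 0 y = 0 \<and> u \<in> N y \<longrightarrow> y = v)))"
proof -
  let ?F = "{''b'', ''j'', ''u'', ''f'', ''k'', ''y''}"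
  let ?J = "\<lambda>B s'. agree ?F s s' \<and>
    (s' ''b'' 0 0 \<noteq> 0 \<longleftrightarrow> (\<exists>u\<in>B. \<forall>y\<in>V. s ''X'' 0 y = 0 \<and> u \<in> N y \<longrightarrow> y = v))"
  show ?thesis unfolding private_child_prog_def
  proof (rule runs_le, rule runs_Seq_nested, rule runs_Assign,
      rule runs_foreach_child[where J = ?J and F = ?F and t = "card V * 74 + 36" and v = v], goal_cases)
    case 1
    show ?case by (rule input_agree[OF s(1) agree_update[OF agree_refl, of _ ?F]]) auto
  next
    case (9 B s')
    then show ?case by (auto simp: agree_def update_cell_other)
  next
    case (11 B s')
    have "input s'" using 11(3) by (intro input_agree[OF s(1), of ?F]) auto
    moreover have "s' ''v'' 0 0 = v" "s' ''X'' = s ''X''" using 11(3) s(2) by (auto simp: agree_def)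
    ultimately have r: "runs other_parent_prog s' (card V * 74 + 16) (\<lambda>s''.
       agree {''f'', ''k'', ''y''} s' s'' \<and>
       (s'' ''f'' 0 0 \<noteq> 0 \<longleftrightarrow> (\<exists>y\<in>V. s ''X'' 0 y = 0 \<and> s' ''u'' 0 0 \<in> N y \<and> y \<noteq> v)))"
      using runs_other_parent[of s' _ v] by simp
    show ?case
    proof (rule runs_le, rule runs_Seq[OF r], rule runs_loop_free, goal_cases)
      case (2 s1)
      then have "s1 ''b'' = s' ''b''" "s1 ''j'' = s' ''j''" "agree ?F s s1"
        using 11(3) by (auto simp: agree_def)
      then show ?case using 2 11(3) by (auto simp: agree_update update_cell_same update_cell_other)
    qed auto
  qed (use s in \<open>auto simp: agree_refl agree_update update_cell_same update_cell_other algebra_simps\<close>)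
qed

text \<open>The tables \<open>X\<close> and \<open>G\<close> mark complements, so that tables filled
  with zeros represent the full vertex set.\<close>

definition kept :: "memory \<Rightarrow> nat set" where
  "kept s = {v \<in> V. s ''X'' 0 v = 0}"

definition left :: "memory \<Rightarrow> nat set" where
  "left s = {v \<in> V. s ''G'' 0 v = 0}"

lemma kept_cong: "s' ''X'' = s ''X'' \<Longrightarrow> kept s' = kept s"
  by (simp add: kept_def)

lemma left_cong: "s' ''G'' = s ''G'' \<Longrightarrow> left s' = left s"
  by (simp add: left_def)

lemma kept_update: "0 < k \<Longrightarrow> kept (update_cell s ''X'' 0 v k) = kept s - {v}"
  by (auto simp: kept_def update_cell_same)

lemma left_update: "0 < k \<Longrightarrow> left (update_cell s ''G'' 0 v k) = left s - {v}"
  by (auto simp: left_def update_cell_same)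

text \<open>One pass achieves minimality: the kept set only shrinks, so a private child once found
  stays private, and a vertex is discarded only if each of its children has another kept
  parent.\<close>

lemma runs_total_dominating:
  assumes s: "input s" "\<And>v. s ''X'' 0 v = 0"
  shows "runs total_dominating_prog s (card V * (d * (card V * 74 + 64) + 62) + 12) (\<lambda>s'.
     agree {''X'', ''i'', ''v'', ''b'', ''j'', ''u'', ''f'', ''k'', ''y''} s s' \<and>
     minimal_total_dominating (kept s'))"
proof -
  let ?F = "{''X'', ''i'', ''v'', ''b'', ''j'', ''u'', ''f'', ''k'', ''y''}"
  let ?D = "\<lambda>W. \<forall>u\<in>V. \<exists>w\<in>W. u \<in> N w"
  let ?P = "\<lambda>B W. \<forall>w\<in>B \<inter> W. \<exists>p. private_child W w p"
  let ?J = "\<lambda>B s'. agree ?F s s' \<and> ?D (kept s') \<and> ?P B (kept s')"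
  have "runs total_dominating_prog s (card V * ((d * (card V * 74 + 64) + 38) + 24) + 12) (?J V)"
    unfolding total_dominating_prog_def
  proof (rule runs_foreach_vertex[where J = ?J and F = ?F], goal_cases)
    case 5
    have "kept s = V" using s(2) by (auto simp: kept_def)
    then show ?case using has_parent by (auto simp: agree_refl)
  next
    case (6 B s' m)
    have "kept (update_cell s' x 0 0 m) = kept s'" if "x \<in> {''i'', ''v''}" for x
      using that by (intro kept_cong) (auto simp: update_cell_other)
    then show ?case using 6 by (auto simp: agree_update)
  next
    case (9 B s')
    let ?v = "s' ''v'' 0 0"
    have "input s'" using 9(3) by (intro input_agree[OF s(1), of ?F]) auto
    then have r: "runs private_child_prog s' (d * (card V * 74 + 64) + 18) (\<lambda>s1.
       agree {''b'', ''j'', ''u'', ''f'', ''k'', ''y''} s' s1 \<and>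
       (s1 ''b'' 0 0 \<noteq> 0 \<longleftrightarrow> (\<exists>u\<in>N ?v. \<forall>y\<in>V. s' ''X'' 0 y = 0 \<and> u \<in> N y \<longrightarrow> y = ?v)))"
      using 9(2) by (intro runs_private_child) auto
    show ?case
    proof (rule runs_le, rule runs_Seq[OF r], rule runs_loop_free, goal_cases)
      case (2 s1)
      have eq: "s1 ''v'' = s' ''v''" "s1 ''i'' = s' ''i''" "s1 ''X'' = s' ''X''" "agree ?F s s1"
        using 2 9(3) by (auto simp: agree_def)
      have kept: "kept s1 = kept s'" by (simp add: kept_def eq)
      show ?case
      proof (cases "s1 ''b'' 0 0 = 0")
        case True
        then have other: "\<exists>y\<in>kept s'. u \<in> N y \<and> y \<noteq> ?v" if "u \<in> N ?v" for u
          using 2 that unfolding kept_def by blast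
        have "?D (kept s' - {?v})"
        proof
          fix u assume "u \<in> V"
          then obtain w where "w \<in> kept s'" "u \<in> N w" using 9(3) by blast
          then show "\<exists>w\<in>kept s' - {?v}. u \<in> N w" using other[of u] by (cases "w = ?v") blast+
        qed
        moreover have "?P (insert ?v B) (kept s' - {?v})"
        proof
          fix w assume w: "w \<in> insert ?v B \<inter> (kept s' - {?v})"
          then obtain p where "private_child (kept s') w p" using 9(3) by blast
          then show "\<exists>p. private_child (kept s' - {?v}) w p" unfolding private_child_def by blast
        qed
        ultimately show ?thesis using True eq
          by (simp add: kept_update kept agree_update update_cell_other)
      next
        case False
        then have "\<exists>p. private_child (kept s') ?v p"
          using 2 unfolding private_child_def kept_def by blast
        then have "?P (insert ?v B) (kept s')" using 9(3) by blast
        then show ?thesis using False eq 9(3) by (simp add: kept)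
      qed
    qed auto
  qed (use s in \<open>auto simp: agree_update\<close>)
  then show ?thesis
    by (rule runs_weaken) (auto simp: minimal_total_dominating_def kept_def)
qed

definition key :: "memory \<Rightarrow> nat \<Rightarrow> nat" where
  "key s v = (if v \<in> kept s then 2 + card (N v \<inter> left s - kept s) else 1)"

lemma runs_count:
  assumes s: "input s" "s ''v'' 0 0 = v" "v \<in> V"
  shows "runs count_prog s (d * 58 + 18) (\<lambda>s'. agree {''key'', ''j'', ''u''} s s' \<and>
    s' ''key'' 0 0 = 2 + card (N v \<inter> left s - kept s))"
proof -
  let ?F = "{''key'', ''j'', ''u''}"
  let ?J = "\<lambda>B s'. agree ?F s s' \<and> s' ''key'' 0 0 = 2 + card (B \<inter> left s - kept s)"
  show ?thesis unfolding count_prog_def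
  proof (rule runs_le, rule runs_Seq_nested, rule runs_Assign,
      rule runs_foreach_child[where J = ?J and F = ?F and t = 30 and v = v], goal_cases)
    case 1
    show ?case by (rule input_agree[OF s(1) agree_update[OF agree_refl, of _ ?F]]) auto
  next
    case (9 B s')
    then show ?case by (auto simp: agree_def update_cell_other)
  next
    case (11 B s')
    let ?u = "s' ''u'' 0 0"
    have eq: "s' ''X'' = s ''X''" "s' ''G'' = s ''G''" using 11(3) by (simp_all add: agree_def)
    have u: "?u \<in> V" "?u \<notin> B" using 11(2) N_subset[OF s(3)] by auto
    have finB: "finite (B \<inter> left s - kept s)"
      using 11(1) finite_N[OF s(3)] by (meson finite_Diff finite_Int finite_subset)
    have "card (insert ?u B \<inter> left s - kept s) =
       card (B \<inter> left s - kept s) + (if s ''G'' 0 ?u = 0 \<and> s ''X'' 0 ?u \<noteq> 0 then 1 else 0)"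
    proof (cases "?u \<in> left s - kept s")
      case True
      then have "insert ?u B \<inter> left s - kept s = insert ?u (B \<inter> left s - kept s)" by blast
      moreover have "s ''G'' 0 ?u = 0 \<and> s ''X'' 0 ?u \<noteq> 0" using True by (auto simp: left_def kept_def)
      ultimately show ?thesis using finB u(2) by simp
    next
      case False
      then have "insert ?u B \<inter> left s - kept s = B \<inter> left s - kept s" by blast
      moreover have "\<not> (s ''G'' 0 ?u = 0 \<and> s ''X'' 0 ?u \<noteq> 0)"
        using False u(1) by (auto simp: left_def kept_def)
      ultimately show ?thesis by simp
    qed
    then show ?case using 11(3)
      by (intro runs_loop_free_le) (auto simp: eq agree_update update_cell_same update_cell_other)
  qed (use s in \<open>auto simp: agree_refl agree_update update_cell_same update_cell_other\<close>)
qed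

lemma runs_key:
  assumes s: "input s" "s ''v'' 0 0 = v" "v \<in> V"
  shows "runs key_prog s (d * 58 + 30) (\<lambda>s'. agree {''key'', ''j'', ''u''} s s' \<and>
    s' ''key'' 0 0 = key s v)"
  unfolding key_prog_def
proof (rule runs_le, rule runs_Cond[where t\<^sub>1 = "d * 58 + 18" and t\<^sub>2 = 4], goal_cases)
  case 1
  then have "v \<in> kept s" using s by (simp add: kept_def)
  then show ?case by (intro runs_weaken[OF runs_count[OF s]]) (auto simp: key_def)
next
  case 2
  then have "v \<notin> kept s" using s by (simp add: kept_def)
  then show ?case
    by (intro runs_loop_free_le) (simp_all add: key_def agree_update agree_refl update_cell_same)
qed auto

lemma runs_best:
  assumes s: "input s"
  shows "runs best_prog s (card V * (d * 58 + 100) + 16) (\<lambda>s'.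
    agree {''best'', ''w'', ''i'', ''v'', ''key'', ''j'', ''u''} s s' \<and>
    (s' ''best'' 0 0 = 0 \<longleftrightarrow> left s = {}) \<and>
    (left s \<noteq> {} \<longrightarrow> s' ''w'' 0 0 \<in> left s \<and> (\<forall>a\<in>left s. key s a \<le> key s (s' ''w'' 0 0))))"
proof -
  let ?F = "{''best'', ''w'', ''i'', ''v'', ''key'', ''j'', ''u''}"
  let ?J = "\<lambda>B s'. agree ?F s s' \<and> (s' ''best'' 0 0 = 0 \<longleftrightarrow> B \<inter> left s = {}) \<and>
    (B \<inter> left s \<noteq> {} \<longrightarrow> s' ''w'' 0 0 \<in> left s \<and> s' ''best'' 0 0 = key s (s' ''w'' 0 0)) \<and>
    (\<forall>a\<in>B \<inter> left s. key s a \<le> s' ''best'' 0 0)"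
  have "runs best_prog s ((1 + acost (Const 0) + acost (Const 0) + acost (Const 0)) +
      (card V * ((d * 58 + 76) + 24) + 12)) (?J V)"
    unfolding best_prog_def
  proof (rule runs_Seq_nested, rule runs_Assign,
      rule runs_foreach_vertex[where J = ?J and F = ?F], goal_cases)
    case 1
    show ?case by (rule input_agree[OF s(1) agree_update[OF agree_refl, of _ ?F]]) auto
  next
    case (7 B s')
    then show ?case by (auto simp: agree_def update_cell_other)
  next
    case (9 B s')
    let ?v = "s' ''v'' 0 0"
    have v: "?v \<in> V" using 9(2) by simp
    have eq: "s' ''G'' = s ''G''" "s' ''X'' = s ''X''" using 9(3) by (simp_all add: agree_def)
    have inp: "input s'" using 9(3) by (intro input_agree[OF s(1), of ?F]) auto
    have keq: "key s' ?v = key s ?v"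
      by (simp add: key_def left_def kept_def eq)
    have r: "runs key_prog s' (d * 58 + 30) (\<lambda>s1. agree {''key'', ''j'', ''u''} s' s1 \<and>
       s1 ''key'' 0 0 = key s ?v)"
      using runs_key[OF inp refl v] by (simp add: keq)
    \<comment> \<open>Hence \<open>best\<close> leaves its initial value 0 as soon as a remaining
      vertex has been visited.\<close>
    have key_pos: "0 < key s a" for a by (simp add: key_def)
    show ?case
    proof (rule runs_le, rule runs_Cond[where t\<^sub>2 = 1], rule runs_Seq[OF r], rule runs_loop_free, goal_cases)
      case (2 s1)
      have v: "?v \<in> left s" using 2(1) v eq by (simp add: left_def)
      have e: "s1 ''best'' = s' ''best''" "s1 ''v'' = s' ''v''" "s1 ''w'' = s' ''w''"
        "s1 ''i'' = s' ''i''" "agree ?F s s1"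
        using 2 9(3) by (auto simp: agree_def)
      show ?case
      proof (cases "s' ''best'' 0 0 < key s ?v")
        case True
        have "key s a \<le> key s ?v" if "a \<in> B \<inter> left s" for a
        proof -
          have "key s a \<le> s' ''best'' 0 0" using 9(3) that by blast
          then show ?thesis using True by simp
        qed
        then show ?thesis using 2(2) e v 9(3) True
          by (auto simp: agree_update update_cell_same update_cell_other)
      next
        case False
        then show ?thesis using 2(2) e v 9(3) key_pos[of ?v] by auto
      qed
    next
      case 3
      have "?v \<notin> left s" using 3 eq by (simp add: left_def)
      then show ?case using 9(3) by (intro runs_Skip) auto
    qed auto
  qed (auto simp: agree_refl agree_update update_cell_same update_cell_other)
  moreover have "V \<inter> left s = left s" by (auto simp: left_def)
  ultimately show ?thesis by (elim runs_weaken) auto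
qed

lemma runs_remove:
  assumes s: "input s" "s ''w'' 0 0 = w" "w \<in> V" "s ''m'' 0 0 = m"
  shows "runs remove_prog s (d * 34 + 36) (\<lambda>s'. agree {''T'', ''m'', ''G'', ''j'', ''u''} s s' \<and>
    s' ''m'' 0 0 = Suc m \<and> s' ''T'' 0 = (s ''T'' 0)(m := w) \<and>
    left s' = left s - insert w (N w))"
proof -
  let ?F = "{''T'', ''m'', ''G'', ''j'', ''u''}"
  let ?J = "\<lambda>B s'. agree ?F s s' \<and> s' ''m'' 0 0 = Suc m \<and> s' ''T'' 0 = (s ''T'' 0)(m := w) \<and>
    left s' = left s - insert w B"
  let ?s = "update_cell (update_cell (update_cell s ''T'' 0 m w) ''m'' 0 0 (Suc m)) ''G'' 0 w 1"
  have F: "agree ?F s ?s" by (simp add: agree_update agree_refl)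
  have T: "?s ''T'' 0 = (s ''T'' 0)(m := w)"
    by (auto simp: update_cell_same update_cell_other)
  have L: "left ?s = left s - {w}"
    by (auto simp: left_def update_cell_same update_cell_other)
  show ?thesis unfolding remove_prog_def
  proof (rule runs_le, rule runs_Seq_nested, rule runs_Assign, rule runs_Seq_nested, rule runs_Assign,
      rule runs_Seq_nested, rule runs_Assign,
      rule runs_foreach_child[where J = ?J and F = ?F and v = w and t = 6], goal_cases)
    case 1
    have "input ?s" by (rule input_agree[OF s(1) F]) auto
    then show ?case using s by (simp add: update_cell_same update_cell_other)
  next
    case 7
    then show ?case using s F T L by (simp add: update_cell_same update_cell_other)
  next
    case (8 B s' k)
    have "left (update_cell s' x 0 0 k) = left s'" if "x \<in> {''j'', ''u''}" for x
      using that by (intro left_cong) (auto simp: update_cell_other)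
    then show ?case using 8 by (auto simp: agree_update update_cell_other)
  next
    case (9 B s')
    then have "agree ?F s s'" by simp
    then show ?case using s by (simp add: agree_def update_cell_same update_cell_other)
  next
    case (11 B s')
    then show ?case
      by (intro runs_loop_free_le) (auto simp: agree_update update_cell_other left_update)
  qed (use s in \<open>auto simp: update_cell_same update_cell_other\<close>)
qed

text \<open>If a vertex of \<open>W\<close> remains, the maximal key is at least 2, which forces
  \<open>w\<close> into \<open>W\<close>. Within \<open>W\<close> the keys are the numbers of
  remaining children outside \<open>W\<close>, shifted by 2.\<close>

lemma greedy_snoc_key:
  assumes "greedy (kept s) vs" "left s = remaining vs" "w \<in> left s"
    "\<And>a. a \<in> left s \<Longrightarrow> key s a \<le> key s w"
  shows "greedy (kept s) (vs @ [w])"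
proof (rule greedy.snoc[OF assms(1)])
  show "w \<in> remaining vs" using assms by simp
  show "w \<in> kept s \<and> (\<forall>a\<in>remaining vs \<inter> kept s.
       card (N a \<inter> remaining vs - kept s) \<le> card (N w \<inter> remaining vs - kept s))
     \<or> remaining vs \<inter> kept s = {}"
  proof (cases "remaining vs \<inter> kept s = {}")
    case False
    then obtain a where "a \<in> remaining vs" "a \<in> kept s" by blast
    then have "2 \<le> key s w" using assms(2) assms(4)[of a] by (simp add: key_def)
    then have "w \<in> kept s" by (simp add: key_def split: if_splits)
    then show ?thesis using assms(4) by (fastforce simp: key_def assms(2))
  qed simp
qed

lemma greedy_full_length:
  assumes "greedy W vs" "length vs = card V"
  shows "remaining vs = {}"
proof -
  have "card (set vs) = card V" using greedy_sorted[OF assms(1)] assms(2) by (simp add: distinct_card)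
  then have "set vs = V" using greedy_sorted[OF assms(1)] finite_V by (intro card_subset_eq) auto
  then show ?thesis by (auto simp: remaining_def)
qed

lemma runs_greedy:
  assumes s: "input s" "s ''m'' 0 0 = 0" "\<And>v. s ''G'' 0 v = 0"
  shows "runs greedy_prog s (card V * (card V * (d * 58 + 100) + d * 34 + 80) + 12) (\<lambda>s'.
    agree {''t'', ''best'', ''w'', ''i'', ''v'', ''key'', ''j'', ''u'', ''T'', ''m'', ''G''} s s' \<and>
    (\<exists>vs. greedy (kept s) vs \<and> remaining vs = {} \<and> s' ''m'' 0 0 = length vs \<and>
      (\<forall>i<length vs. s' ''T'' 0 i = vs ! i)))"
proof -
  let ?F = "{''t'', ''best'', ''w'', ''i'', ''v'', ''key'', ''j'', ''u'', ''T'', ''m'', ''G''}"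
  let ?R = "\<lambda>s' vs. greedy (kept s) vs \<and> s' ''m'' 0 0 = length vs \<and>
      (\<forall>i<length vs. s' ''T'' 0 i = vs ! i) \<and> left s' = remaining vs"
  \<comment> \<open>After \<open>k\<close> rounds the list has length \<open>k\<close> unless the
    process has already ended; by \<open>greedy_full_length\<close> nothing remains in either case
    after \<open>card V\<close> rounds.\<close>
  let ?I = "\<lambda>k s'. agree ?F s s' \<and> (\<exists>vs. ?R s' vs \<and> (length vs = k \<or> remaining vs = {}))"
  have "runs greedy_prog s (card V * ((card V * (d * 58 + 100) + d * 34 + 64) + acost (var ''n'') + 13)
      + acost (var ''n'') + 9) (?I (card V))"
    unfolding greedy_prog_def
  proof (rule runs_For[where I = ?I], goal_cases)
    case 1
    have "left s = V" using s(3) by (auto simp: left_def)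
    then show ?case using s(2) greedy.Nil by (auto simp: agree_refl remaining_def)
  next
    case (2 k s' m)
    have "left (update_cell s' ''t'' 0 0 m) = left s'" by (rule left_cong) (simp add: update_cell_other)
    then show ?case using 2 by (simp add: agree_update update_cell_other)
  next
    case (3 k s')
    then have "s' ''n'' = s ''n''" by (simp add: agree_def)
    then show ?case using s(1) by (simp add: input_def)
  next
    case (4 k s')
    then obtain vs where vs: "?R s' vs" "length vs = k \<or> remaining vs = {}" by blast
    have A: "agree ?F s s'" using 4 by blast
    have inp: "input s'" by (rule input_agree[OF s(1) A]) auto
    have "s' ''X'' = s ''X''" using A by (simp add: agree_def)
    then have kept: "kept s' = kept s" by (simp add: kept_def)
    show ?case
    proof (rule runs_le, rule runs_Seq[OF runs_best[OF inp]],
        rule runs_Cond[where t\<^sub>1 = "d * 34 + 36" and t\<^sub>2 = 1], goal_cases)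
      case (1 s1)
      have e: "s1 ''m'' = s' ''m''" "s1 ''T'' = s' ''T''" "s1 ''t'' = s' ''t''" "s1 ''G'' = s' ''G''"
        "agree ?F s s1"
        using 1(1) A by (auto simp: agree_def)
      let ?w = "s1 ''w'' 0 0"
      have w: "?w \<in> left s'" "\<And>a. a \<in> left s' \<Longrightarrow> key s' a \<le> key s' ?w" using 1 by auto
      have gr: "greedy (kept s) (vs @ [?w])"
        using greedy_snoc_key[of s' vs ?w] w vs(1) unfolding kept by blast
      have len: "length vs = k" using vs w(1) by auto
      have left: "left s1 = remaining vs" using vs(1) e by (simp add: left_def)
      have inp1: "input s1" by (rule input_agree[OF s(1) e(5)]) auto
      have wV: "?w \<in> V" using w(1) by (simp add: left_def)
      have m1: "s1 ''m'' 0 0 = length vs" using vs(1) e by simp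
      show ?case
      proof (rule runs_weaken[OF runs_remove[OF inp1 refl wV m1]])
        fix s2 assume s2: "agree {''T'', ''m'', ''G'', ''j'', ''u''} s1 s2 \<and>
           s2 ''m'' 0 0 = Suc (length vs) \<and> s2 ''T'' 0 = (s1 ''T'' 0)(length vs := ?w) \<and>
           left s2 = left s1 - insert ?w (N ?w)"
        have "agree ?F s s2" "s2 ''t'' = s1 ''t''" using s2 e(5) by (auto simp: agree_def)
        moreover have "?R s2 (vs @ [?w])"
          using s2 gr vs(1) e left by (auto simp: remaining_snoc nth_append less_Suc_eq)
        ultimately show "s2 ''t'' 0 0 = k \<and> ?I (Suc k) s2" using e(3) 4(3) len
          by (intro conjI exI[of _ "vs @ [?w]"]) auto
      qed simp
    next
      case (2 s1)
      have e: "s1 ''m'' = s' ''m''" "s1 ''T'' = s' ''T''" "s1 ''t'' = s' ''t''" "s1 ''G'' = s' ''G''"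
        "agree ?F s s1"
        using 2(1) A by (auto simp: agree_def)
      have "left s1 = left s'" using e by (simp add: left_def)
      moreover have "left s' = {}" using 2 by simp
      ultimately show ?case using e vs 4(3) by (intro runs_Skip) auto
    qed auto
  qed
  then show ?thesis using greedy_full_length by (elim runs_weaken) auto
qed

lemma runs_insert:
  assumes s: "input s" "s ''v'' 0 0 = v" "v \<in> V"
  shows "runs insert_prog s (d * 34 + 20) (\<lambda>s'. agree {''Q'', ''K'', ''j'', ''u''} s s' \<and>
    {x. s' ''Q'' 0 x \<noteq> 0} = insert v {x. s ''Q'' 0 x \<noteq> 0} \<and>
    {x. s' ''K'' 0 x \<noteq> 0} = {x. s ''K'' 0 x \<noteq> 0} \<union> N v)"
proof -
  let ?F = "{''Q'', ''K'', ''j'', ''u''}"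
  let ?J = "\<lambda>B s'. agree ?F s s' \<and>
    {x. s' ''Q'' 0 x \<noteq> 0} = insert v {x. s ''Q'' 0 x \<noteq> 0} \<and>
    {x. s' ''K'' 0 x \<noteq> 0} = {x. s ''K'' 0 x \<noteq> 0} \<union> B"
  show ?thesis unfolding insert_prog_def
  proof (rule runs_le, rule runs_Seq_nested, rule runs_Assign,
      rule runs_foreach_child[where J = ?J and F = ?F and v = v and t = 6], goal_cases)
    case 1
    show ?case by (rule input_agree[OF s(1) agree_update[OF agree_refl, of _ ?F]]) auto
  next
    case (9 B s')
    then have "agree ?F s s'" by simp
    then show ?case by (auto simp: agree_def update_cell_other)
  next
    case (11 B s')
    then show ?case
      by (intro runs_loop_free_le) (auto simp: agree_update update_cell_same update_cell_other)
  qed (use s in \<open>auto simp: agree_refl agree_update update_cell_same update_cell_other\<close>)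
qed

lemma runs_kernel:
  assumes s: "input s" "s ''m'' 0 0 = length vs" "\<And>i. i < length vs \<Longrightarrow> s ''T'' 0 i = vs ! i"
    "\<And>v. s ''Q'' 0 v = 0" "\<And>v. s ''K'' 0 v = 0"
    and vs: "distinct vs" "set vs \<subseteq> V"
  shows "runs kernel_prog s (card V * (d * 34 + 60) + 12) (\<lambda>s'. result s' = list_kernel N vs)"
proof -
  let ?F = "{''i'', ''v'', ''Q'', ''K'', ''j'', ''u''}"
  \<comment> \<open>The kernel of the last \<open>k\<close> list elements; in the invariant,
    \<open>K\<close> marks the union of its out-neighbourhoods.\<close>
  let ?L = "\<lambda>k. list_kernel N (drop (length vs - k) vs)"
  let ?I = "\<lambda>k s'. agree ?F s s' \<and> {x. s' ''Q'' 0 x \<noteq> 0} = ?L k \<and>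
    {x. s' ''K'' 0 x \<noteq> 0} = \<Union> (N ` ?L k)"
  have "runs kernel_prog s (length vs * ((d * 34 + 44) + acost (var ''m'') + 13)
      + acost (var ''m'') + 9) (?I (length vs))"
    unfolding kernel_prog_def
  proof (rule runs_For[where I = ?I], goal_cases)
    case 1
    show ?case using s(4,5) by (simp add: agree_refl)
  next
    case (2 k s' m)
    then show ?case by (simp add: agree_update update_cell_other)
  next
    case (3 k s')
    then have "s' ''m'' = s ''m''" by (simp add: agree_def)
    then show ?case using s(2) by simp
  next
    case (4 k s')
    \<comment> \<open>Round \<open>k\<close>, counted from 0, handles the element immediately before
      the last \<open>k\<close> ones.\<close>
    define i where "i = length vs - Suc k"
    have i: "i < length vs" "length vs - k = Suc i" "length vs - Suc k = i" using 4(1) by (auto simp: i_def)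
    define v where "v = vs ! i"
    have v: "v \<in> V" using i(1) vs(2) by (auto simp: v_def)
    have L: "?L (Suc k) = (if v \<in> \<Union> (N ` ?L k) then ?L k else insert v (?L k))"
      unfolding i(2,3) Cons_nth_drop_Suc[OF i(1), symmetric] v_def by simp
    have e: "s' ''m'' = s ''m''" "s' ''T'' = s ''T''" using 4(2) by (auto simp: agree_def)
    let ?s = "update_cell s' ''v'' 0 0 v"
    have A: "agree ?F s ?s" using 4(2) by (simp add: agree_update)
    have inp: "input ?s" by (rule input_agree[OF s(1) A]) auto
    have sv: "?s ''v'' 0 0 = v" by (simp add: update_cell_same)
    have eq: "?s ''Q'' = s' ''Q''" "?s ''K'' = s' ''K''" "?s ''i'' = s' ''i''"
      by (simp_all add: update_cell_other)
    have "v \<in> {x. s' ''K'' 0 x \<noteq> 0} \<longleftrightarrow> v \<in> \<Union> (N ` ?L k)" using 4(2) by simp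
    then have K: "bval (Less (arr ''K'' (var ''v'')) (Const 1)) ?s \<longleftrightarrow> v \<notin> \<Union> (N ` ?L k)"
      by (auto simp: eq sv)
    have av: "aval (arr ''T'' (Minus (var ''m'') (Plus (var ''i'') (Const 1)))) s' = v"
      using e s(2) s(3)[OF i(1)] 4(3) i by (simp add: v_def)
    have rc: "runs (Cond (Less (arr ''K'' (var ''v'')) (Const 1)) insert_prog Skip) ?s
       (d * 34 + 30) (\<lambda>s2. s2 ''i'' 0 0 = k \<and> ?I (Suc k) s2)"
    proof (rule runs_le, rule runs_Cond[where t\<^sub>1 = "d * 34 + 20" and t\<^sub>2 = 1], goal_cases)
      case 1
      then have nv: "v \<notin> \<Union> (N ` ?L k)" unfolding K .
      show ?case
      proof (rule runs_weaken[OF runs_insert[OF inp sv v]])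
        fix s2 assume s2: "agree {''Q'', ''K'', ''j'', ''u''} ?s s2 \<and>
          {x. s2 ''Q'' 0 x \<noteq> 0} = insert v {x. ?s ''Q'' 0 x \<noteq> 0} \<and>
          {x. s2 ''K'' 0 x \<noteq> 0} = {x. ?s ''K'' 0 x \<noteq> 0} \<union> N v"
        have "agree ?F s s2" using s2 A by (auto elim: agree_trans)
        moreover have "s2 ''i'' = s' ''i''" using s2 eq(3) by (auto simp: agree_def)
        moreover have "?L (Suc k) = insert v (?L k)" using nv L by simp
        ultimately show "s2 ''i'' 0 0 = k \<and> ?I (Suc k) s2"
          using s2 4(2,3) eq by auto
      qed simp
    next
      case 2
      then have "v \<in> \<Union> (N ` ?L k)" unfolding K by simp
      then have "?L (Suc k) = ?L k" using L by simp
      then show ?case using 4(2,3) A eq by (intro runs_Skip) simp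
    qed auto
    show ?case
    proof (rule runs_le, rule runs_Seq_nested[where t\<^sub>2 = "d * 34 + 30"], rule runs_Assign, goal_cases)
      case 1
      show ?case unfolding av aval.simps(1) by (rule rc)
    qed simp
  qed
  then have "runs kernel_prog s (length vs * (d * 34 + 60) + 12) (?I (length vs))"
    by (rule runs_le) simp
  moreover have "length vs \<le> card V"
    using vs finite_V by (metis card_mono distinct_card)
  ultimately show ?thesis
    by (elim runs_weaken) (auto simp: result_def)
qed

lemma runs_quasi_kernel:
  assumes s: "input s" "\<And>x i j. x \<in> {''X'', ''m'', ''G'', ''Q'', ''K''} \<Longrightarrow> s x i j = 0"
  shows "runs quasi_kernel_prog s
     (time_bound d (card V))
    (\<lambda>s'. \<exists>W vs. minimal_total_dominating W \<and> greedy W vs \<and> remaining vs = {} \<and>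
       result s' = list_kernel N vs)"
  unfolding quasi_kernel_prog_def time_bound_def
proof (rule runs_Seq[OF runs_total_dominating], goal_cases)
  case (3 s1)
  have i1: "input s1" using 3 by (intro input_agree[OF s(1)]) auto
  \<comment> \<open>The first phase does not write these tables, so the later phases still find them
    filled with zeros.\<close>
  have z1: "s1 ''m'' = s ''m''" "s1 ''G'' = s ''G''" "s1 ''Q'' = s ''Q''" "s1 ''K'' = s ''K''"
    using 3 by (auto simp: agree_def)
  show ?case
  proof (rule runs_Seq[OF runs_greedy[OF i1]], goal_cases)
    case (3 s2)
    then obtain vs where vs: "greedy (kept s1) vs" "remaining vs = {}" "s2 ''m'' 0 0 = length vs"
      "\<And>i. i < length vs \<Longrightarrow> s2 ''T'' 0 i = vs ! i" by blast
    have i2: "input s2" using 3 by (intro input_agree[OF i1]) auto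
    have z2: "s2 ''Q'' = s1 ''Q''" "s2 ''K'' = s1 ''K''" using 3 by (auto simp: agree_def)
    have "runs kernel_prog s2 (card V * (d * 34 + 60) + 12) (\<lambda>s'. result s' = list_kernel N vs)"
      using greedy_sorted[OF vs(1)] by (intro runs_kernel i2 vs) (auto simp: z2 z1 s(2))
    then show ?case
      using vs(1,2) \<open>agree _ s s1 \<and> minimal_total_dominating (kept s1)\<close> by (elim runs_weaken) blast+
  qed (auto simp: z1 s(2))
qed (auto simp: s)

end

section \<open>Digraphs\<close>

abbreviation out_nbrs :: "'a pair_pre_digraph \<Rightarrow> 'a \<Rightarrow> 'a set" where
  "out_nbrs D \<equiv> \<lambda>v. {u. v \<rightarrow>\<^bsub>D\<^esub> u}"

lemma out_nbhds_pair_digraph: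
  assumes D: "pair_digraph D" "sourceless D" "max_out_degree D \<le> d" and "2 \<le> d"
  shows "out_nbhds (pverts D) (out_nbrs D) d"
proof -
  interpret pair_digraph D by (rule D(1))
  have arc: "v \<rightarrow>\<^bsub>D\<^esub> u \<longleftrightarrow> (v, u) \<in> parcs D" for u v
    by (simp add: arcs_ends_def arc_to_ends_def)
  show ?thesis
  proof
    fix v assume v: "v \<in> pverts D"
    show "{u. v \<rightarrow>\<^bsub>D\<^esub> u} \<subseteq> pverts D" using arc in_arcsD2 by auto
    have "{u. v \<rightarrow>\<^bsub>D\<^esub> u} = snd ` out_arcs D v" by (force simp: arc out_arcs_def)
    then have "card {u. v \<rightarrow>\<^bsub>D\<^esub> u} \<le> out_degree D v"
      unfolding out_degree_def by (metis card_image_le finite_out_arcs)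
    also have "out_degree D v \<le> max_out_degree D"
      unfolding max_out_degree_def using v by (intro cSUP_upper) auto
    finally show "card {u. v \<rightarrow>\<^bsub>D\<^esub> u} \<le> d" using D(3) by simp
    have "in_arcs D v \<noteq> {}" using D(2) v unfolding sourceless_def in_degree_def by force
    then obtain e where "e \<in> parcs D" "snd e = v" by (auto simp: in_arcs_def)
    then show "\<exists>u\<in>pverts D. v \<in> {x. u \<rightarrow>\<^bsub>D\<^esub> x}"
      using arc in_arcsD1 by (metis mem_Collect_eq prod.collapse)
  next
    show "v \<notin> {u. v \<rightarrow>\<^bsub>D\<^esub> u}" for v using arc no_loops' by auto
  qed (use \<open>2 \<le> d\<close> in auto)
qed

lemma dist_to_le:
  fixes D :: "'a pair_pre_digraph"
  assumes "pre_digraph.apath D v p u" "length p \<le> n"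
  shows "dist_to D v u \<le> enat n"
  unfolding dist_to_def using assms by (intro order_trans[OF INF_lower[of p]]) auto

text \<open>\<open>dist_to\<close> ranges over paths without repeated vertices. Therefore
  \<open>u = v\<close> is treated apart, and in the two-arc case loop-freeness makes the middle
  vertex differ from both ends.\<close>

lemma dist_to_le_2:
  fixes D :: "'a pair_pre_digraph"
  assumes D: "pair_digraph D"
    and v: "v \<in> pverts D" "u = v \<or> v \<rightarrow>\<^bsub>D\<^esub> u \<or> (\<exists>w. v \<rightarrow>\<^bsub>D\<^esub> w \<and> w \<rightarrow>\<^bsub>D\<^esub> u)"
  shows "dist_to D v u \<le> 2"
proof -
  interpret pair_digraph D by (rule D)
  have arc: "v \<rightarrow>\<^bsub>D\<^esub> u \<longleftrightarrow> (v, u) \<in> parcs D" for u v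
    by (simp add: arcs_ends_def arc_to_ends_def)
  have ne: "x \<noteq> y" if "(x, y) \<in> parcs D" for x y using that no_loops' by auto
  have "\<exists>p. apath v p u \<and> length p \<le> 2"
  proof (cases "u = v")
    case True
    then show ?thesis using v(1) by (intro exI[of _ "[]"]) (simp add: apath_Nil_iff)
  next
    case False
    show ?thesis
    proof (cases "v \<rightarrow>\<^bsub>D\<^esub> u")
      case True
      then show ?thesis using False arc in_arcsD2
        by (intro exI[of _ "[(v, u)]"]) (auto simp: apath_Cons_iff apath_Nil_iff)
    next
      case nadj: False
      then obtain w where "(v, w) \<in> parcs D" "(w, u) \<in> parcs D" using v(2) False arc by auto
      then show ?thesis using False arc in_arcsD2 ne
        by (intro exI[of _ "[(v, w), (w, u)]"]) (auto simp: apath_Cons_iff apath_Nil_iff)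
    qed
  qed
  then show ?thesis using dist_to_le[of D v _ u 2] by (auto simp: numeral_eq_enat)
qed

lemma (in out_nbhds) list_kernel_bound:
  assumes "minimal_total_dominating W" "greedy W vs" "remaining vs = {}"
  shows "real (card (list_kernel N vs)) \<le> (real d ^ 2 + 4) * real (card V) / (real d + 2) ^ 2"
proof -
  have "real ((d + 2)\<^sup>2 * card (list_kernel N vs)) \<le> real ((d\<^sup>2 + 4) * card V)"
    using card_list_kernel_greedy[OF assms] by (simp only: of_nat_le_iff)
  moreover have "0 < (real d + 2) ^ 2" by simp
  ultimately show ?thesis by (simp add: pos_le_divide_eq mult.commute add.commute)
qed

lemma quasi_kernel_list_kernel:
  fixes D :: "'a pair_pre_digraph"
  assumes D: "pair_digraph D"
    and nbhds: "out_nbhds (pverts D) (out_nbrs D) d"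
    and gr: "out_nbhds.greedy (pverts D) (out_nbrs D) W vs"
      "out_nbhds.remaining (pverts D) (out_nbrs D) vs = {}"
  shows "quasi_kernel D (list_kernel (out_nbrs D) vs)"
proof -
  interpret out_nbhds "pverts D" "out_nbrs D" d by (rule nbhds)
  let ?S = "list_kernel (out_nbrs D) vs"
  have S: "?S \<subseteq> pverts D" using list_kernel_subset[of "out_nbrs D" vs] greedy_sorted[OF gr(1)] by blast
  have "\<exists>v\<in>?S. dist_to D v u \<le> 2" if "u \<in> pverts D" for u
    using list_kernel_two_dominates[OF gr(2) that] dist_to_le_2[OF D] S by blast
  moreover have "\<not> u \<rightarrow>\<^bsub>D\<^esub> v" if "u \<in> ?S" "v \<in> ?S" for u v
    using list_kernel_independent[OF N_irrefl _ that] greedy_sorted[OF gr(1)] by blast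
  ultimately show ?thesis using S unfolding quasi_kernel_def independent_set_def by blast
qed

section \<open>Quadratic growth and the two claims of the theorem\<close>

lemma time_bound_bigo: "(\<lambda>n. real (time_bound d n)) \<in> O(\<lambda>n. real n ^ 2)"
\<comment> \<open>The constant is the sum of all coefficients of \<open>time_bound d n\<close>,
  since \<open>n\<close> and \<open>1\<close> are at most \<open>n * n\<close> for
  \<open>n \<ge> 1\<close>.\<close>
proof (rule bigoI[of _ "real (264 * d + 338)"], rule eventually_mono[OF eventually_ge_at_top[of 1]])
  fix n :: nat assume "1 \<le> n"
  then have n: "n \<le> n * n" "1 \<le> n * n" by auto
  have "time_bound d n = (n * n) * (132 * d + 100) + (n * (132 * d + 202) + 36 * 1)"
    by (simp add: time_bound_def algebra_simps)
  also have "\<dots> \<le> (n * n) * (132 * d + 100) + ((n * n) * (132 * d + 202) + 36 * (n * n))"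
    using n by (intro add_left_mono add_mono mult_le_mono1 mult_le_mono2)
  also have "\<dots> = (264 * d + 338) * n ^ 2" by (simp add: algebra_simps power2_eq_square)
  finally have "real (time_bound d n) \<le> real ((264 * d + 338) * n ^ 2)"
    by (simp only: of_nat_le_iff)
  then show "norm (real (time_bound d n)) \<le> real (264 * d + 338) * norm (real n ^ 2)" by simp
qed

lemma stores_input:
  fixes D :: "nat pair_pre_digraph"
  assumes "nat_out_nbhds (pverts D) (out_nbrs D) d" "stores s D"
  shows "nat_out_nbhds.input (pverts D) (out_nbrs D) s"
proof -
  interpret nat_out_nbhds "pverts D" "out_nbrs D" d by (rule assms(1))
  \<comment> \<open>\<open>out_degree\<close> counts arcs, whereas the set on the right consists of
    vertices; the stored enumeration is a bijection that equates the two numbers.\<close>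
  have "out_degree D v = card {u. v \<rightarrow>\<^bsub>D\<^esub> u}" if "v \<in> pverts D" for v
  proof -
    have "bij_betw (s ''out'' v) {..<out_degree D v} {u. v \<rightarrow>\<^bsub>D\<^esub> u}"
      using assms(2) that by (simp add: stores_def)
    from bij_betw_same_card[OF this] show ?thesis by simp
  qed
  then show ?thesis using assms(2) unfolding stores_def input_def by simp
qed

lemma ex_small_quasi_kernel:
  assumes "2 \<le> d" and D: "pair_digraph D" "sourceless D" "max_out_degree D \<le> d"
  shows "\<exists>Q. quasi_kernel D Q \<and>
    real (card Q) \<le> (real d ^ 2 + 4) * real (card (pverts D)) / (real d + 2) ^ 2"
proof -
  interpret out_nbhds "pverts D" "out_nbrs D" d
    by (rule out_nbhds_pair_digraph[OF D assms(1)])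
  obtain W vs where vs: "minimal_total_dominating W" "greedy W vs" "remaining vs = {}"
    using ex_minimal_total_dominating ex_greedy_exhaustive by blast
  show ?thesis
    using quasi_kernel_list_kernel[OF D(1) out_nbhds_axioms vs(2,3)] list_kernel_bound[OF vs] by blast
qed

lemma quasi_kernel_prog_correct:
  assumes "2 \<le> d" and D: "pair_digraph D" "sourceless D" "max_out_degree D \<le> d"
    and s: "stores s D"
  shows "\<exists>t s'. exec quasi_kernel_prog s t s' \<and> t \<le> time_bound d (card (pverts D)) \<and>
    quasi_kernel D (result s') \<and>
    real (card (result s')) \<le> (real d ^ 2 + 4) * real (card (pverts D)) / (real d + 2) ^ 2"
proof -
  interpret nat_out_nbhds "pverts D" "out_nbrs D" d
    unfolding nat_out_nbhds_def by (rule out_nbhds_pair_digraph[OF D assms(1)])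
  have "input s" by (rule stores_input[OF nat_out_nbhds_axioms s])
  moreover have "s x i j = 0" if "x \<in> {''X'', ''m'', ''G'', ''Q'', ''K''}" for x i j
    using s that unfolding stores_def by auto
  ultimately have "runs quasi_kernel_prog s (time_bound d (card (pverts D)))
     (\<lambda>s'. \<exists>W vs. minimal_total_dominating W \<and> greedy W vs \<and> remaining vs = {} \<and>
       result s' = list_kernel (out_nbrs D) vs)"
    by (rule runs_quasi_kernel)
  then obtain t s' W vs where r: "exec quasi_kernel_prog s t s'"
      "t \<le> time_bound d (card (pverts D))"
    and vs: "minimal_total_dominating W" "greedy W vs" "remaining vs = {}"
    and res: "result s' = list_kernel (out_nbrs D) vs"
    unfolding runs_def by blast
  show ?thesis
    using r quasi_kernel_list_kernel[OF D(1) out_nbhds_axioms vs(2,3)] list_kernel_bound[OF vs]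
    unfolding res[symmetric] by blast
qed

theorem theorem1p5:
  fixes d :: nat
  assumes "d \<ge> 2"
  shows
    "(\<forall>D :: 'a pair_pre_digraph.
        pair_digraph D \<and> sourceless D \<and> max_out_degree D \<le> d \<and>
        \<not> contains_copy D C3_directed \<and> \<not> contains_copy D C4_minus \<and>
        \<not> contains_copy D C4_upup \<and> \<not> contains_copy D C6_upup \<longrightarrow>
        (\<exists>Q. quasi_kernel D Q \<and>
             real (card Q) \<le> (real d ^ 2 + 4) * real (card (pverts D)) / (real d + 2) ^ 2)) \<and>
     (\<exists>(prog :: com) (T :: nat \<Rightarrow> nat).
        (\<lambda>n. real (T n)) \<in> O(\<lambda>n. real n ^ 2) \<and>
        (\<forall>(D :: nat pair_pre_digraph) s.
           pair_digraph D \<and> sourceless D \<and> max_out_degree D \<le> d \<and>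
           \<not> contains_copy D C3_directed \<and> \<not> contains_copy D C4_minus \<and>
           \<not> contains_copy D C4_upup \<and> \<not> contains_copy D C6_upup \<and> stores s D \<longrightarrow>
           (\<exists>t s'. exec prog s t s' \<and> t \<le> T (card (pverts D)) \<and>
              quasi_kernel D (result s') \<and>
              real (card (result s'))
                \<le> (real d ^ 2 + 4) * real (card (pverts D)) / (real d + 2) ^ 2)))"
  \<comment> \<open>The existence claim concerns an arbitrary vertex type and so rests on the
    abstract greedy list. For the algorithm the witnesses are \<open>quasi_kernel_prog\<close>, the
    same program for every \<open>d\<close>, and \<open>time_bound d\<close>.\<close>
  using ex_small_quasi_kernel[OF assms] quasi_kernel_prog_correct[OF assms] time_bound_bigo
  by (intro conjI) blast+

end
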